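(* If there exists $\gamma\in(1/2,1)$ such that $\sum_n 2^{-\gamma n}N_n^2<\infty$, then $$P\big(\Lambda(\omega)\text{ is }\mathcal{D}\text{-separated}\big)=1.$$ If for all $\gamma\in(1/2,1)$ we have $\sum_n 2^{-\gamma n}N_n^2=\infty$, then $$P\big(\Lambda(\omega)\text{ is }\mathcal{D}\text{-separated}\big)=0.$$
   Context: $\mathbb{D}$ is the open unit disk. Random sequence: $(\rho_n)\subset[0,1)$ is a fixed (deterministic) sequence of radii, $(\theta_n(\omega))$ is a sequence of independent random variables, all uniformly distributed on $[0,2\pi]$, and $\Lambda(\omega)=\{\lambda_n\}$ is the set of points $\lambda_n=\rho_n e^{i\theta_n(\omega)}$. For $n=0,1,2,\ldots$, $N_n=\#\{\lambda\in\Lambda(\omega): 1-2^{-n}\le|\lambda|<1-2^{-n-1}\}$; almost surely this depends only on the radii. Sums over $n$ run over $n\ge0$. $\mathcal{D}$ is the classical Dirichlet space of analytic functions $f$ on $\mathbb{D}$ with $\int_{\mathbb{D}}|f'|^2\,dA<\infty$, $dA=dx\,dy/\pi$, with reproducing kernel (for an equivalent norm) $k_z(w)=\frac{1}{\overline{z}w}\log\frac{1}{1-\overline{z}w}$ (equal to $1$ when $\overline{z}w=0$). Set $$\rho_{\mathcal{D}}(z,w)=\sqrt{1-\frac{|k_w(z)|^2}{k_z(z)k_w(w)}},\qquad z,w\in\mathbb{D}.$$ A sequence $\Lambda$ is called $\mathcal{D}$-separated if $\inf_{\lambda,\lambda^*\in\Lambda,\ \lambda\neq\lambda^*}\rho_{\mathcal{D}}(\lambda,\lambda^*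 )>\delta_\Lambda>0$ for some $\delta_\Lambda<1$. *)

theory Defs
  imports "HOL-Probability.Probability"
begin

text \<open>
  Reproducing kernel \<open>k\<^sub>z(w)\<close> of the Dirichlet space (for an equivalent norm). For \<open>z\<close>, \<open>w\<close> in the
  unit disk \<open>1 - cnj z * w\<close> has positive real part, so the principal branch is the intended logarithm.
\<close>
definition dirichlet_kernel :: "complex \<Rightarrow> complex \<Rightarrow> complex" where
  "dirichlet_kernel z w =
     (if cnj z * w = 0 then 1 else 1 / (cnj z * w) * Ln (1 / (1 - cnj z * w)))"

text \<open>On the diagonal the kernel is real and positive, hence \<open>Re\<close> only changes the type there.\<close>
definition rho_D :: "complex \<Rightarrow> complex \<Rightarrow> real" where
  "rho_D z w = sqrt (1 - (cmod (dirichlet_kernel w z))\<^sup>2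
                       / (Re (dirichlet_kernel z z) * Re (dirichlet_kernel w w)))"

text \<open>
  The infimum is taken in the extended reals, so that it is \<open>\<infinity>\<close> when there are no two distinct points.
\<close>
definition D_separated :: "complex set \<Rightarrow> bool" where
  "D_separated \<Lambda> \<longleftrightarrow>
     (\<exists>\<delta>::real. 0 < \<delta> \<and> \<delta> < 1 \<and>
        ereal \<delta> < (INF (z, w)\<in>{(z, w). z \<in> \<Lambda> \<and> w \<in> \<Lambda> \<and> z \<noteq> w}. ereal (rho_D z w)))"

definition random_points :: "(nat \<Rightarrow> real) \<Rightarrow> (nat \<Rightarrow> 'a \<Rightarrow> real) \<Rightarrow> 'a \<Rightarrow> complex set" where
  "random_points \<rho> \<theta> \<omega> = range (\<lambda>k. rcis (\<rho> k) (\<theta> k \<omega>))"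

text \<open>
  The number \<open>N\<^sub>n\<close> of points of \<open>\<Lambda>\<close> in the \<open>n\<close>-th dyadic annulus; counting measure gives \<open>\<infinity>\<close> for
  infinitely many points, where \<open>card\<close> would give \<open>0\<close>.
\<close>
definition annulus_count :: "complex set \<Rightarrow> nat \<Rightarrow> ennreal" where
  "annulus_count \<Lambda> n =
     emeasure (count_space UNIV)
       {z \<in> \<Lambda>. 1 - (1/2) ^ n \<le> cmod z \<and> cmod z < 1 - (1/2) ^ (n + 1)}"

definition weighted_count_sum :: "real \<Rightarrow> complex set \<Rightarrow> ennreal" where
  "weighted_count_sum \<gamma> \<Lambda> = (\<Sum>n. ennreal (2 powr (- \<gamma> * real n)) * (annulus_count \<Lambda> n)\<^sup>2)"

end

theory Submission
  imports Defs "HOL-Complex_Analysis.Cauchy_Integral_Theorem"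
begin

text \<open>
  Write \<open>K(x) = \<Sum>n. x\<^sup>n / (n + 1)\<close>, so that the kernel is \<open>k\<^sub>w(z) = K(cnj w * z)\<close>, and put
  \<open>A = K(\<bar>z\<bar>\<^sup>2)\<close>, \<open>B = K(\<bar>w\<bar>\<^sup>2)\<close>. Up to bounded errors \<open>A\<close> and \<open>B\<close> are \<open>- ln (1 - \<bar>z\<bar>)\<close> and
  \<open>- ln (1 - \<bar>w\<bar>)\<close>, while \<open>\<bar>k\<^sub>w(z)\<bar>\<close> is \<open>- ln \<bar>1 - cnj w * z\<bar>\<close>. The points are \<open>D\<close>-separated when
  \<open>\<bar>k\<^sub>w(z)\<bar>\<^sup>2 \<le> c A B\<close> for a fixed \<open>c < 1\<close> and all pairs, essentially, when \<open>- ln \<bar>1 - cnj w * z\<bar>\<close>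
  stays a fixed proportion below the geometric mean of \<open>A\<close> and \<open>B\<close>.

  Convergence implies separation. Two bounds hold for a pair with \<open>A \<le> B\<close>: always \<open>\<bar>k\<^sub>w(z)\<bar> \<le> A + 1\<close>, and
  \<open>\<bar>k\<^sub>w(z)\<bar> \<le> g (A + B) / 2 + 6\<close> as soon as \<open>\<bar>1 - cnj w * z\<bar> \<ge> ((1 - \<bar>z\<bar>\<^sup>2) (1 - \<bar>w\<bar>\<^sup>2)) powr (g / 2)\<close>.
  For \<open>g < 1\<close> the minimum of \<open>A\<close> and \<open>g (A + B) / 2\<close> is at most a proportion of \<open>sqrt (A B)\<close>: the first
  is small compared with it when \<open>B\<close> exceeds \<open>A\<close> by a factor, the second when \<open>A\<close> and \<open>B\<close> are
  comparable. Hence only pairs that violate the inequality, and pairs in a compact part of the disk, can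
  be badly separated (\<open>far_apart_imp_rho_D_ge\<close>). The threshold is a product of a function of \<open>z\<close> and one
  of \<open>w\<close>, and a pair violates the inequality with probability at most twice the threshold. So the expected
  number of violating pairs is at most a constant times the square of \<open>\<Sum>k. (1 - \<rho>\<^sub>k\<^sup>2) powr (g / 2)\<close>,
  taken over the points other than the origin, which is finite
  for \<open>g > \<gamma>\<close> because the hypothesis forces \<open>N\<^sub>n = O(2 powr (\<gamma> n / 2))\<close>. By Borel--Cantelli only
  finitely many pairs of points are left, and for each of them \<open>\<rho>\<^sub>D\<close> is positive by the strict
  Cauchy--Schwarz inequality.

  Divergence excludes separation. If an annulus contains infinitely many points, they accumulate inside
  the disk, where \<open>\<rho>\<^sub>D\<close> is continuous and vanishes on the diagonal. Otherwise fix \<open>\<gamma>\<close> close to \<open>1\<close> and cut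
  the circle into about \<open>2 powr (\<gamma> n)\<close> arcs of equal length. The events that two given points of the
  \<open>n\<close>-th annulus lie in the same arc are pairwise independent, even when the pairs share a point,
  and their probabilities have sum of order \<open>\<Sum>n. 2 powr (- \<gamma> n) N\<^sub>n (N\<^sub>n - 1) = \<infinity>\<close>. Chebyshev's inequality
  shows that one of them occurs almost surely, with \<open>n\<close> as large as desired. Two such points satisfy
  \<open>\<bar>1 - cnj w * z\<bar> = O(2 powr (- \<gamma> n))\<close>, hence \<open>\<bar>k\<^sub>w(z)\<bar>\<^sup>2 / (A B)\<close> is almost \<open>\<gamma>\<^sup>2\<close> or larger
  (\<open>close_imp_rho_D_le\<close>). Letting \<open>\<gamma>\<close> tend to \<open>1\<close> makes \<open>\<rho>\<^sub>D\<close> arbitrarily small.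
\<close>

section \<open>The kernel as a power series\<close>

text \<open>
  The function of one variable with \<open>k\<^sub>z(w) = kernel_profile (cnj z * w)\<close>.
\<close>
definition kernel_profile :: "complex \<Rightarrow> complex" where
  "kernel_profile x = (if x = 0 then 1 else 1 / x * Ln (1 / (1 - x)))"

text \<open>
  The restriction of \<open>kernel_profile\<close> to \<open>[0,1)\<close>, as a real function. At \<open>\<bar>z\<bar>\<^sup>2\<close> it is the squared norm of
  the kernel at \<open>z\<close>, which serves as a logarithmic measure of how close \<open>z\<close> is to the circle.
\<close>
definition diag_profile :: "real \<Rightarrow> real" where
  "diag_profile t = (if t = 0 then 1 else - ln (1 - t) / t)"

lemma dirichlet_kernel_eq_profile: "dirichlet_kernel z w = kernel_profile (cnj z * w)"
  by (simp add: dirichlet_kernel_def kernel_profile_def)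

lemma Ln_inverse_one_minus:
  fixes x :: complex
  assumes "cmod x < 1"
  shows "Ln (1 / (1 - x)) = - Ln (1 - x)"
proof -
  have "Re x < 1"
    using assms complex_Re_le_cmod le_less_trans by blast
  then have "1 - x \<notin> \<real>\<^sub>\<le>\<^sub>0"
    by (auto simp: complex_nonpos_Reals_iff)
  then show ?thesis
    by (simp add: Ln_inverse inverse_eq_divide[symmetric])
qed

lemma kernel_profile_sums:
  assumes "cmod x < 1"
  shows "(\<lambda>n. x ^ n / of_nat (Suc n)) sums kernel_profile x"
proof (cases "x = 0")
  case True
  have "(\<lambda>n. (if n = 0 then 1 else 0) :: complex) sums 1"
    using sums_single[of 0 "\<lambda>_. 1::complex"] by simp
  moreover have "(\<lambda>n. x ^ n / of_nat (Suc n)) = (\<lambda>n. (if n = 0 then 1 else 0))"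
    using True by (auto simp: fun_eq_iff)
  ultimately show ?thesis
    using True by (simp add: kernel_profile_def)
next
  case False
  have "(\<lambda>n. - (x ^ n) / of_nat n) sums ln (1 - x)"
    using Ln_series'[of "- x"] assms by simp
  then have "(\<lambda>n. - (x ^ Suc n) / of_nat (Suc n)) sums ln (1 - x)"
    by (subst sums_Suc_iff) simp
  then have "(\<lambda>n. - 1 / x * (- (x ^ Suc n) / of_nat (Suc n))) sums (- 1 / x * ln (1 - x))"
    by (rule sums_mult)
  then show ?thesis
    using False Ln_inverse_one_minus[OF assms] by (simp add: kernel_profile_def)
qed

lemma kernel_profile_of_real:
  assumes "0 \<le> t" "t < 1"
  shows "kernel_profile (of_real t) = of_real (diag_profile t)"
proof -
  have "Ln (1 - complex_of_real t) = of_real (ln (1 - t))"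
    using assms by (metis Ln_of_real diff_gt_0_iff_gt of_real_1 of_real_diff)
  then show ?thesis
    using assms Ln_inverse_one_minus[of "of_real t"]
    by (auto simp: kernel_profile_def diag_profile_def)
qed

lemma diag_profile_sums:
  assumes "0 \<le> t" "t < 1"
  shows "(\<lambda>n. t ^ n / real (Suc n)) sums diag_profile t"
proof -
  have "(\<lambda>n. complex_of_real (t ^ n / real (Suc n))) sums of_real (diag_profile t)"
    using kernel_profile_sums[of "of_real t"] assms by (simp add: kernel_profile_of_real)
  then show ?thesis
    by (subst (asm) sums_of_real_iff)
qed

lemma dirichlet_kernel_diag:
  assumes "cmod z < 1"
  shows "Re (dirichlet_kernel z z) = diag_profile ((cmod z)\<^sup>2)"
proof -
  have "cnj z * z = of_real ((cmod z)\<^sup>2)"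
    by (metis complex_norm_square mult.commute)
  moreover have "(cmod z)\<^sup>2 < 1"
    using assms by (simp add: power_less_one_iff abs_square_less_1)
  ultimately show ?thesis
    by (simp add: dirichlet_kernel_eq_profile kernel_profile_of_real del: of_real_power)
qed

lemma norm_kernel_profile_le:
  assumes "cmod x < 1"
  shows "cmod (kernel_profile x) \<le> diag_profile (cmod x)"
proof -
  have s: "(\<lambda>n. cmod (x ^ n / of_nat (Suc n))) sums diag_profile (cmod x)"
    using diag_profile_sums[of "cmod x"] assms by (simp add: norm_divide norm_power del: of_nat_Suc)
  have "cmod (\<Sum>n. x ^ n / of_nat (Suc n)) \<le> (\<Sum>n. cmod (x ^ n / of_nat (Suc n)))"
    by (rule summable_norm) (use s sums_summable in blast)
  then show ?thesis
    using s kernel_profile_sums[OF assms] by (simp add: sums_iff)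
qed

lemma diag_profile_mono:
  assumes "0 \<le> s" "s \<le> t" "t < 1"
  shows "diag_profile s \<le> diag_profile t"
proof (rule sums_le)
  show "(\<lambda>n. s ^ n / real (Suc n)) sums diag_profile s" "(\<lambda>n. t ^ n / real (Suc n)) sums diag_profile t"
    using assms by (auto intro!: diag_profile_sums simp del: of_nat_Suc)
  show "s ^ n / real (Suc n) \<le> t ^ n / real (Suc n)" for n
    using assms by (intro divide_right_mono power_mono) auto
qed

lemma diag_profile_ge_1:
  assumes "0 \<le> t" "t < 1"
  shows "1 \<le> diag_profile t"
  using diag_profile_mono[of 0 t] assms by (simp add: diag_profile_def)

lemma diag_profile_mult: "t * diag_profile t = - ln (1 - t)"
  by (simp add: diag_profile_def)

lemma diag_profile_ge_log:
  assumes "0 \<le> t" "t < 1"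
  shows "- ln (1 - t) \<le> diag_profile t"
proof -
  have "t * diag_profile t \<le> 1 * diag_profile t"
    using assms diag_profile_ge_1[OF assms] by (intro mult_right_mono) auto
  then show ?thesis by (simp add: diag_profile_mult)
qed

lemma one_minus_mult_diag_profile_le:
  assumes "0 \<le> t" "t < 1"
  shows "(1 - t) * diag_profile t \<le> 1"
proof -
  have "diag_profile t \<le> 1 / (1 - t)"
  proof (rule sums_le)
    show "(\<lambda>n. t ^ n / real (Suc n)) sums diag_profile t"
      by (rule diag_profile_sums[OF assms])
    show "(\<lambda>n. t ^ n) sums (1 / (1 - t))"
      using assms by (intro geometric_sums) auto
    show "t ^ n / real (Suc n) \<le> t ^ n" for n
      using assms by (simp add: field_simps)
  qed
  then show ?thesis
    using assms by (simp add: field_simps)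
qed

lemma diag_profile_le_log:
  assumes "0 \<le> t" "t < 1"
  shows "diag_profile t \<le> 1 - ln (1 - t)"
  using one_minus_mult_diag_profile_le[OF assms] diag_profile_mult[of t] by (simp add: algebra_simps)

text \<open>
  Passing from \<open>r\<^sup>2\<close> to \<open>r\<close> adds only a bounded amount, because \<open>1 - r\<^sup>2 = (1 - r) (1 + r)\<close> differs from
  \<open>1 - r\<close> by a bounded factor. The additive form, with coefficient \<open>1\<close> in front of the logarithm, is
  essential: a multiplicative constant would spoil the comparison with \<open>sqrt (A B)\<close>.
\<close>
lemma diag_profile_le_square:
  assumes "0 \<le> r" "r < 1"
  shows "diag_profile r \<le> diag_profile (r\<^sup>2) + 1"
proof (cases "r = 0")
  case False
  have r2: "r\<^sup>2 < 1" using assms by (simp add: power_less_one_iff abs_square_less_1)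
  have "1 - r\<^sup>2 = (1 - r) * (1 + r)" by (simp add: power2_eq_square algebra_simps)
  then have "ln (1 - r\<^sup>2) = ln (1 - r) + ln (1 + r)"
    using assms by (simp add: ln_mult)
  then have "r\<^sup>2 * diag_profile (r\<^sup>2) = r * diag_profile r - ln (1 + r)"
    by (simp add: diag_profile_mult)
  moreover have "ln (1 + r) \<le> r" using assms by (simp add: ln_add_one_self_le_self)
  ultimately have "r * diag_profile r \<le> r * (r * diag_profile (r\<^sup>2) + 1)"
    by (simp add: power2_eq_square algebra_simps)
  then have "diag_profile r \<le> r * diag_profile (r\<^sup>2) + 1"
    using False assms by simp
  also have "r * diag_profile (r\<^sup>2) \<le> 1 * diag_profile (r\<^sup>2)"
    using assms diag_profile_ge_1[OF _ r2] by (intro mult_right_mono) auto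
  finally show ?thesis by simp
qed (simp add: diag_profile_def)

lemma norm_kernel_profile_mult:
  "cmod x * cmod (kernel_profile x) = cmod (Ln (1 / (1 - x)))"
  by (simp add: kernel_profile_def norm_mult norm_divide)

text \<open>
  The factor \<open>1 / x\<close> in the kernel costs only an additive constant, even near \<open>x = 0\<close>: the absolute
  values of \<open>K x\<close> and \<open>x * K x\<close> differ by at most \<open>(1 - \<bar>x\<bar>) K(\<bar>x\<bar>)\<close>, and
  \<open>(1 - t) K(t) \<le> 1\<close> by comparison with the geometric series.
\<close>
lemma norm_kernel_profile_le_log:
  assumes "cmod x < 1"
  shows "cmod (kernel_profile x) \<le> cmod (Ln (1 / (1 - x))) + 1"
proof -
  have "(1 - cmod x) * cmod (kernel_profile x) \<le> (1 - cmod x) * diag_profile (cmod x)"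
    using assms norm_kernel_profile_le by (intro mult_left_mono) auto
  also have "\<dots> \<le> 1"
    using assms by (intro one_minus_mult_diag_profile_le) auto
  finally show ?thesis
    using norm_kernel_profile_mult[of x] by (simp add: algebra_simps)
qed

lemma norm_mult_cnj_less_1:
  assumes "cmod z < 1" "cmod w < 1"
  shows "cmod (cnj w * z) < 1"
proof -
  have "cmod w * cmod z \<le> cmod w * 1"
    using assms by (intro mult_left_mono) auto
  then show ?thesis using assms by (simp add: norm_mult)
qed

lemma cmod_diff_square: "(cmod (a - b))\<^sup>2 = (cmod a)\<^sup>2 - 2 * Re (a * cnj b) + (cmod b)\<^sup>2"
  unfolding cmod_power2 by (simp add: power2_eq_square algebra_simps)

text \<open>
  The kernel at \<open>z\<close> is represented by the coefficients \<open>z\<^sup>n / sqrt (n + 1)\<close>. Equality in Cauchy--Schwarz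
  would make the coefficient sequences of \<open>z\<close> and \<open>w\<close> proportional; the coefficient at \<open>n = 0\<close> then forces the
  factor to be \<open>1\<close>, and the one at \<open>n = 1\<close> forces \<open>z = w\<close>.
\<close>
lemma kernel_Cauchy_Schwarz_strict:
  assumes z: "cmod z < 1" and w: "cmod w < 1" and "z \<noteq> w"
  shows "(cmod (kernel_profile (cnj w * z)))\<^sup>2 < diag_profile ((cmod z)\<^sup>2) * diag_profile ((cmod w)\<^sup>2)"
proof (rule ccontr)
  define A B K where "A = diag_profile ((cmod z)\<^sup>2)" and "B = diag_profile ((cmod w)\<^sup>2)"
    and "K = kernel_profile (cnj w * z)"
  assume "\<not> ?thesis"
  then have le: "A * B \<le> (cmod K)\<^sup>2" by (simp add: A_def B_def K_def)
  have z2: "(cmod z)\<^sup>2 < 1" and w2: "(cmod w)\<^sup>2 < 1"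
    using z w by (simp_all add: power_less_one_iff abs_square_less_1)
  have "B \<ge> 1" unfolding B_def by (rule diag_profile_ge_1) (use w2 in auto)
  \<comment> \<open>the terms of the squared norm of \<open>B k\<^sub>z - K k\<^sub>w\<close>, up to conjugation; their sum is \<open>B (A B - \<bar>K\<bar>\<^sup>2)\<close>\<close>
  let ?f = "\<lambda>n. (cmod (of_real B * z ^ n - K * w ^ n))\<^sup>2 / real (Suc n)"
  have expand: "?f n = B\<^sup>2 * (((cmod z)\<^sup>2) ^ n / real (Suc n))
      - 2 * B * Re (cnj K * ((cnj w * z) ^ n / of_nat (Suc n)))
      + (cmod K)\<^sup>2 * (((cmod w)\<^sup>2) ^ n / real (Suc n))" for n
  proof -
    have "(cmod (of_real B * z ^ n - K * w ^ n))\<^sup>2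
        = (cmod (of_real B * z ^ n))\<^sup>2 - 2 * Re (of_real B * z ^ n * cnj (K * w ^ n)) + (cmod (K * w ^ n))\<^sup>2"
      by (rule cmod_diff_square)
    also have "of_real B * z ^ n * cnj (K * w ^ n) = of_real B * (cnj K * (cnj w * z) ^ n)"
      by (simp add: power_mult_distrib mult_ac)
    also have "Re \<dots> = B * Re (cnj K * (cnj w * z) ^ n)" by simp
    finally have "(cmod (of_real B * z ^ n - K * w ^ n))\<^sup>2
      = B\<^sup>2 * ((cmod z)\<^sup>2) ^ n - 2 * B * Re (cnj K * (cnj w * z) ^ n) + (cmod K)\<^sup>2 * ((cmod w)\<^sup>2) ^ n"
      by (simp add: norm_mult norm_power power_mult_distrib power_mult[symmetric] mult.commute)
    moreover have "Re (cnj K * ((cnj w * z) ^ n / of_nat (Suc n))) = Re (cnj K * (cnj w * z) ^ n) / real (Suc n)"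
      by (metis Re_divide_of_nat times_divide_eq_right)
    ultimately show ?thesis
      by (simp add: diff_divide_distrib add_divide_distrib distrib_left del: of_nat_Suc)
  qed
  have "?f sums (B\<^sup>2 * A - 2 * B * Re (cnj K * K) + (cmod K)\<^sup>2 * B)"
    unfolding expand
    using z2 w2 z w unfolding A_def B_def
    by (intro sums_add sums_diff sums_mult diag_profile_sums sums_Re)
      (auto simp: K_def intro!: kernel_profile_sums norm_mult_cnj_less_1 simp del: of_nat_Suc)
  also have "Re (cnj K * K) = (cmod K)\<^sup>2"
    unfolding cmod_power2 by (simp add: power2_eq_square)
  also have "B\<^sup>2 * A - 2 * B * (cmod K)\<^sup>2 + (cmod K)\<^sup>2 * B = B * (A * B - (cmod K)\<^sup>2)"
    by (simp add: power2_eq_square algebra_simps)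
  finally have s: "?f sums (B * (A * B - (cmod K)\<^sup>2))" .
  \<comment> \<open>the coefficients \<open>n = 0\<close> and \<open>n = 1\<close> suffice\<close>
  have "sum ?f {..<2} \<le> suminf ?f"
    using sums_summable[OF s] by (rule sum_le_suminf) auto
  also have "\<dots> = B * (A * B - (cmod K)\<^sup>2)" using sums_unique[OF s] by (rule sym)
  also have "\<dots> \<le> 0" using le \<open>B \<ge> 1\<close> by (simp add: mult_nonneg_nonpos)
  finally have 0: "(cmod (of_real B - K))\<^sup>2 + (cmod (of_real B * z - K * w))\<^sup>2 / 2 \<le> 0"
    by (simp add: numeral_2_eq_2)
  have "(cmod (of_real B - K))\<^sup>2 = 0" and "(cmod (of_real B * z - K * w))\<^sup>2 = 0"
    using 0 zero_le_power2[of "cmod (of_real B - K)"] zero_le_power2[of "cmod (of_real B * z - K * w)"]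
    by linarith+
  then have "of_real B = K" and "of_real B * z = K * w" by auto
  then show False using \<open>B \<ge> 1\<close> \<open>z \<noteq> w\<close> by auto
qed

section \<open>The kernel at pairs of points that are far apart\<close>

lemma kernel_profile_cnj:
  assumes "cmod x < 1"
  shows "kernel_profile (cnj x) = cnj (kernel_profile x)"
proof (rule sums_unique2)
  show "(\<lambda>n. cnj x ^ n / of_nat (Suc n)) sums kernel_profile (cnj x)"
    using assms by (intro kernel_profile_sums) simp
  have "(\<lambda>n. cnj (x ^ n / of_nat (Suc n))) sums cnj (kernel_profile x)"
    unfolding sums_cnj by (rule kernel_profile_sums[OF assms])
  then show "(\<lambda>n. cnj x ^ n / of_nat (Suc n)) sums cnj (kernel_profile x)"
    by simp
qed

lemma norm_kernel_profile_swap: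
  assumes "cmod z < 1" "cmod w < 1"
  shows "cmod (kernel_profile (cnj z * w)) = cmod (kernel_profile (cnj w * z))"
  using kernel_profile_cnj[OF norm_mult_cnj_less_1[OF assms]]
  by (metis complex_cnj_cnj complex_cnj_mult complex_mod_cnj mult.commute)

lemma rho_D_eq:
  assumes "cmod z < 1" "cmod w < 1"
  shows "rho_D z w = sqrt (1 - (cmod (kernel_profile (cnj w * z)))\<^sup>2
    / (diag_profile ((cmod z)\<^sup>2) * diag_profile ((cmod w)\<^sup>2)))"
  unfolding rho_D_def dirichlet_kernel_diag[OF assms(1)] dirichlet_kernel_diag[OF assms(2)]
  by (simp add: dirichlet_kernel_eq_profile)

lemma diag_profile_norm_ge_1:
  assumes "cmod z < 1"
  shows "1 \<le> diag_profile ((cmod z)\<^sup>2)"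
  using assms by (intro diag_profile_ge_1) (auto simp: power_less_one_iff abs_square_less_1)

lemma rho_D_pos:
  assumes z: "cmod z < 1" and w: "cmod w < 1" and "z \<noteq> w"
  shows "0 < rho_D z w"
proof -
  have "0 < diag_profile ((cmod z)\<^sup>2) * diag_profile ((cmod w)\<^sup>2)"
    using diag_profile_norm_ge_1[OF z] diag_profile_norm_ge_1[OF w] by simp
  then show ?thesis
    using kernel_Cauchy_Schwarz_strict[OF assms] by (simp add: rho_D_eq[OF z w])
qed

text \<open>
  With \<open>A = a\<^sup>2\<close> and \<open>B = b\<^sup>2\<close>: for \<open>a \<le> c b\<close> already \<open>A \<le> c sqrt (A B)\<close>. Otherwise the ratio of \<open>a\<close> and
  \<open>b\<close> lies between \<open>c\<close> and \<open>1/c\<close>, where the quotient of arithmetic and geometric mean of \<open>A\<close> and \<open>B\<close> is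
  at most \<open>(1 + c\<^sup>2) / (2 c)\<close>. The condition on \<open>g\<close> says that \<open>g\<close> times this value is at most \<open>c\<close>.
\<close>
lemma min_le_geometric_mean:
  fixes a b c g :: real
  assumes "0 \<le> a" "a \<le> b" "0 < c" "c \<le> 1" "0 \<le> g" "g * (1 + c\<^sup>2) \<le> 2 * c\<^sup>2"
  shows "min (a\<^sup>2) (g * (a\<^sup>2 + b\<^sup>2) / 2) \<le> c * (a * b)"
proof (cases "a \<le> c * b")
  case True
  have "a * a \<le> a * (c * b)" using True assms(1) by (rule mult_left_mono)
  then have "a\<^sup>2 \<le> c * (a * b)" by (simp add: power2_eq_square mult_ac)
  then show ?thesis by simp
next
  case False
  have ca: "c * a \<le> b"
    using assms by (metis mult.left_neutral mult_right_mono order_trans)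
  have "0 \<le> (a - c * b) * (b - c * a)"
    using False ca by (intro mult_nonneg_nonneg) auto
  then have 1: "c * (a\<^sup>2 + b\<^sup>2) \<le> (1 + c\<^sup>2) * (a * b)"
    by (simp add: power2_eq_square algebra_simps)
  have "c * (g * (a\<^sup>2 + b\<^sup>2)) = g * (c * (a\<^sup>2 + b\<^sup>2))" by simp
  also have "\<dots> \<le> g * ((1 + c\<^sup>2) * (a * b))" using 1 assms by (intro mult_left_mono)
  also have "\<dots> = (g * (1 + c\<^sup>2)) * (a * b)" by simp
  also have "\<dots> \<le> 2 * c\<^sup>2 * (a * b)" using assms by (intro mult_right_mono) auto
  also have "\<dots> = c * (2 * (c * (a * b)))" by (simp add: power2_eq_square)
  finally have "g * (a\<^sup>2 + b\<^sup>2) \<le> 2 * (c * (a * b))"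
    using assms(3) by (simp only: mult_le_cancel_left_pos)
  then show ?thesis by simp
qed

text \<open>
  The point closer to the origin controls the kernel, since \<open>\<bar>cnj w * z\<bar> \<le> \<bar>z\<bar>\<close>.
\<close>
lemma norm_kernel_le_inner:
  assumes "cmod z \<le> cmod w" "cmod w < 1"
  shows "cmod (kernel_profile (cnj w * z)) \<le> diag_profile ((cmod z)\<^sup>2) + 1"
proof -
  have z: "cmod z < 1" using assms by simp
  have "cmod (kernel_profile (cnj w * z)) \<le> diag_profile (cmod (cnj w * z))"
    by (rule norm_kernel_profile_le) (rule norm_mult_cnj_less_1[OF z assms(2)])
  also have "\<dots> \<le> diag_profile (cmod z)"
    using assms z by (intro diag_profile_mono) (auto simp: norm_mult intro!: mult_left_le_one_le)
  also have "\<dots> \<le> diag_profile ((cmod z)\<^sup>2) + 1"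
    by (rule diag_profile_le_square) (use z in auto)
  finally show ?thesis .
qed

text \<open>
  The kernel is essentially the logarithm of \<open>1 / (1 - cnj w * z)\<close>. Its real part is controlled by the
  lower bound on \<open>\<bar>1 - cnj w * z\<bar>\<close>, its imaginary part by \<open>pi\<close>.
\<close>
lemma norm_kernel_le_far:
  assumes z: "cmod z < 1" and w: "cmod w < 1" and "0 \<le> g"
    and far: "((1 - (cmod z)\<^sup>2) * (1 - (cmod w)\<^sup>2)) powr (g / 2) \<le> cmod (1 - cnj w * z)"
  shows "cmod (kernel_profile (cnj w * z))
    \<le> g * (diag_profile ((cmod z)\<^sup>2) + diag_profile ((cmod w)\<^sup>2)) / 2 + 6"
proof -
  define u where "u = 1 - cnj w * z"
  let ?A = "diag_profile ((cmod z)\<^sup>2)" and ?B = "diag_profile ((cmod w)\<^sup>2)"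
  have z2: "(cmod z)\<^sup>2 < 1" and w2: "(cmod w)\<^sup>2 < 1"
    using z w by (simp_all add: power_less_one_iff abs_square_less_1)
  have x: "cmod (cnj w * z) < 1" by (rule norm_mult_cnj_less_1[OF z w])
  have u0: "u \<noteq> 0" using x by (auto simp: u_def)
  have "cmod u \<le> cmod 1 + cmod (cnj w * z)" unfolding u_def by (rule norm_triangle_ineq4)
  then have "cmod u \<le> 2" using x by simp
  then have "ln (cmod u) \<le> ln 2" using u0 by simp
  moreover have "ln 2 \<le> (1::real)" using ln_2_less_1 by simp
  moreover have "- ln (cmod u) \<le> g * (?A + ?B) / 2"
  proof -
    have pos: "0 < (1 - (cmod z)\<^sup>2) * (1 - (cmod w)\<^sup>2)" using z2 w2 by simp
    have "(g / 2) * ln ((1 - (cmod z)\<^sup>2) * (1 - (cmod w)\<^sup>2))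
        = ln (((1 - (cmod z)\<^sup>2) * (1 - (cmod w)\<^sup>2)) powr (g / 2))"
      by (simp add: ln_powr)
    also have "\<dots> \<le> ln (cmod u)"
      using far pos z2 w2 by (subst ln_le_cancel_iff) (auto simp: u_def[symmetric] u0)
    finally have "- ln (cmod u) \<le> (g / 2) * (- ln (1 - (cmod z)\<^sup>2) - ln (1 - (cmod w)\<^sup>2))"
      using ln_mult_pos[of "1 - (cmod z)\<^sup>2" "1 - (cmod w)\<^sup>2"] z2 w2
      by (simp add: distrib_left right_diff_distrib del: distrib_left_numeral)
    also have "\<dots> \<le> (g / 2) * (?A + ?B)"
      using diag_profile_ge_log[OF _ z2] diag_profile_ge_log[OF _ w2] \<open>0 \<le> g\<close>
      by (intro mult_left_mono) auto
    finally show ?thesis by simp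
  qed
  moreover have "0 \<le> g * (?A + ?B) / 2"
    using diag_profile_norm_ge_1[OF z] diag_profile_norm_ge_1[OF w] \<open>0 \<le> g\<close> by simp
  ultimately have ln: "\<bar>ln (cmod u)\<bar> \<le> g * (?A + ?B) / 2 + 1" by linarith
  have "cmod (Ln u) \<le> \<bar>Re (Ln u)\<bar> + \<bar>Im (Ln u)\<bar>" by (rule cmod_le)
  moreover have "\<bar>Im (Ln u)\<bar> \<le> pi"
    using mpi_less_Im_Ln[OF u0] Im_Ln_le_pi[OF u0] by linarith
  ultimately have "cmod (Ln u) \<le> g * (?A + ?B) / 2 + 5"
    using ln pi_less_4 Re_Ln[OF u0] by simp
  moreover have "cmod (Ln (1 / u)) = cmod (Ln u)"
    unfolding u_def using Ln_inverse_one_minus[OF x] by simp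
  ultimately show ?thesis
    using norm_kernel_profile_le_log[OF x] unfolding u_def by simp
qed

text \<open>
  The two bounds on the kernel are combined by \<open>min_le_geometric_mean\<close>. Their additive constants are
  absorbed by enlarging the proportion from \<open>c\<close> to \<open>(1 + c) / 2\<close>: since \<open>A \<ge> 1\<close>, the geometric mean
  \<open>sqrt (A B)\<close> is large as soon as the deeper of the two points is close to the circle.
\<close>
lemma kernel_ratio_bound_ordered:
  fixes g :: real
  assumes "0 < g" "g < 1"
  obtains c B0 where "0 < c" "c < 1"
    "\<And>z w. cmod z \<le> cmod w \<Longrightarrow> cmod w < 1 \<Longrightarrow> B0 \<le> diag_profile ((cmod w)\<^sup>2) \<Longrightarrow>
       ((1 - (cmod z)\<^sup>2) * (1 - (cmod w)\<^sup>2)) powr (g / 2) \<le> cmod (1 - cnj w * z) \<Longrightarrow>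
       cmod (kernel_profile (cnj w * z))
         \<le> c * sqrt (diag_profile ((cmod z)\<^sup>2) * diag_profile ((cmod w)\<^sup>2))"
proof -
  \<comment> \<open>the solution of \<open>g * (1 + c\<^sup>2) = 2 * c\<^sup>2\<close>, the smallest proportion that \<open>min_le_geometric_mean\<close> allows\<close>
  define c where "c = sqrt (g / (2 - g))"
  have c2: "c\<^sup>2 = g / (2 - g)" using assms by (simp add: c_def)
  have c: "0 < c" "c < 1" using assms by (simp_all add: c_def)
  have gc: "g * (1 + c\<^sup>2) = 2 * c\<^sup>2" using assms by (simp add: c2 field_simps)
  \<comment> \<open>chosen so that the additive error \<open>6\<close> is at most \<open>(1 - c) / 2 * sqrt (A * B)\<close>\<close>
  define B0 where "B0 = (12 / (1 - c))\<^sup>2"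
  show thesis
  proof (rule that[of "(1 + c) / 2" B0])
    fix z w :: complex
    assume zw: "cmod z \<le> cmod w" and w: "cmod w < 1"
      and B0: "B0 \<le> diag_profile ((cmod w)\<^sup>2)"
      and far: "((1 - (cmod z)\<^sup>2) * (1 - (cmod w)\<^sup>2)) powr (g / 2) \<le> cmod (1 - cnj w * z)"
    have z: "cmod z < 1" using zw w by simp
    define a b where "a = sqrt (diag_profile ((cmod z)\<^sup>2))" and "b = sqrt (diag_profile ((cmod w)\<^sup>2))"
    let ?K = "cmod (kernel_profile (cnj w * z))"
    have A1: "1 \<le> diag_profile ((cmod z)\<^sup>2)" and B1: "1 \<le> diag_profile ((cmod w)\<^sup>2)"
      using diag_profile_norm_ge_1 z w by auto
    have a2: "diag_profile ((cmod z)\<^sup>2) = a\<^sup>2" and b2: "diag_profile ((cmod w)\<^sup>2) = b\<^sup>2"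
      using A1 B1 by (simp_all add: a_def b_def)
    have ab: "1 \<le> a" "a \<le> b"
      unfolding a_def b_def using A1
      by (auto intro!: diag_profile_mono power_mono zw simp: power_less_one_iff abs_square_less_1 w)
    have "12 / (1 - c) \<le> b"
      using B0 ab unfolding b2 B0_def by (meson order_trans power2_le_imp_le zero_le_one)
    also have "b \<le> a * b" using ab by simp
    finally have large: "6 \<le> (1 - c) / 2 * (a * b)" using c by (simp add: field_simps)
    have "?K \<le> min (a\<^sup>2) (g * (a\<^sup>2 + b\<^sup>2) / 2) + 6"
      using norm_kernel_le_inner[OF zw w] norm_kernel_le_far[OF z w _ far] assms
      unfolding a2 b2 by (auto simp: min_def)
    also have "min (a\<^sup>2) (g * (a\<^sup>2 + b\<^sup>2) / 2) \<le> c * (a * b)"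
      using ab c assms gc by (intro min_le_geometric_mean) auto
    finally have "?K \<le> c * (a * b) + (1 - c) / 2 * (a * b)" using large by simp
    also have "\<dots> = (1 + c) / 2 * (a * b)" by (simp add: field_simps)
    finally show "?K \<le> (1 + c) / 2 * sqrt (diag_profile ((cmod z)\<^sup>2) * diag_profile ((cmod w)\<^sup>2))"
      unfolding a_def b_def by (simp add: real_sqrt_mult)
  qed (use c in auto)
qed

lemma far_apart_imp_rho_D_ge:
  fixes g :: real
  assumes "0 < g" "g < 1"
  obtains d B0 where "0 < d"
    "\<And>z w. cmod z < 1 \<Longrightarrow> cmod w < 1 \<Longrightarrow>
       B0 \<le> max (diag_profile ((cmod z)\<^sup>2)) (diag_profile ((cmod w)\<^sup>2)) \<Longrightarrow>
       ((1 - (cmod z)\<^sup>2) * (1 - (cmod w)\<^sup>2)) powr (g / 2) \<le> cmod (1 - cnj w * z) \<Longrightarrow>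
       d \<le> rho_D z w"
proof -
  obtain c B0 where c: "0 < c" "c < 1" and
    bound: "\<And>z w. cmod z \<le> cmod w \<Longrightarrow> cmod w < 1 \<Longrightarrow> B0 \<le> diag_profile ((cmod w)\<^sup>2) \<Longrightarrow>
       ((1 - (cmod z)\<^sup>2) * (1 - (cmod w)\<^sup>2)) powr (g / 2) \<le> cmod (1 - cnj w * z) \<Longrightarrow>
       cmod (kernel_profile (cnj w * z))
         \<le> c * sqrt (diag_profile ((cmod z)\<^sup>2) * diag_profile ((cmod w)\<^sup>2))"
    using kernel_ratio_bound_ordered[OF assms] by metis
  show thesis
  proof (rule that[of "sqrt (1 - c\<^sup>2)" B0])
    show "0 < sqrt (1 - c\<^sup>2)" using c by (simp add: power_less_one_iff)
    fix z w :: complex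
    assume z: "cmod z < 1" and w: "cmod w < 1"
      and B0: "B0 \<le> max (diag_profile ((cmod z)\<^sup>2)) (diag_profile ((cmod w)\<^sup>2))"
      and far: "((1 - (cmod z)\<^sup>2) * (1 - (cmod w)\<^sup>2)) powr (g / 2) \<le> cmod (1 - cnj w * z)"
    let ?A = "diag_profile ((cmod z)\<^sup>2)" and ?B = "diag_profile ((cmod w)\<^sup>2)"
    have AB: "0 < ?A * ?B"
      using diag_profile_norm_ge_1[OF z] diag_profile_norm_ge_1[OF w] by simp
    have mono: "diag_profile ((cmod x)\<^sup>2) \<le> diag_profile ((cmod y)\<^sup>2)"
      if "cmod x \<le> cmod y" "cmod y < 1" for x y
      using that by (intro diag_profile_mono power_mono) (auto simp: power_less_one_iff abs_square_less_1)
    have "cmod (kernel_profile (cnj w * z)) \<le> c * sqrt (?A * ?B)"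
    proof (cases "cmod z \<le> cmod w")
      case True
      then show ?thesis using B0 mono[OF True w] far w by (intro bound) auto
    next
      case False
      have "cmod (1 - cnj w * z) = cmod (1 - cnj z * w)"
        by (metis complex_cnj_cnj complex_cnj_diff complex_cnj_mult complex_cnj_one complex_mod_cnj mult.commute)
      then have "cmod (kernel_profile (cnj z * w)) \<le> c * sqrt (?B * ?A)"
        using False B0 mono[of w z] far z by (intro bound) (auto simp: mult.commute)
      then show ?thesis unfolding norm_kernel_profile_swap[OF z w] by (simp only: mult.commute[of ?B ?A])
    qed
    then have "(cmod (kernel_profile (cnj w * z)))\<^sup>2 \<le> (c * sqrt (?A * ?B))\<^sup>2"
      by (intro power_mono) auto
    also have "\<dots> = c\<^sup>2 * (?A * ?B)" using AB by (simp add: power_mult_distrib)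
    finally have "(cmod (kernel_profile (cnj w * z)))\<^sup>2 / (?A * ?B) \<le> c\<^sup>2"
      using AB by (simp add: pos_divide_le_eq)
    then show "sqrt (1 - c\<^sup>2) \<le> rho_D z w"
      unfolding rho_D_eq[OF z w] by (intro real_sqrt_le_mono) simp
  qed
qed

section \<open>Pairwise independence and uniform angles\<close>

text \<open>
  Second moment method: for pairwise independent events the variance of the number of events that occur
  is at most its mean, so Chebyshev's inequality bounds the probability that this number is \<open>0\<close>.
\<close>
lemma (in prob_space) prob_no_pairwise_indep_event_le:
  assumes I: "finite I" and A: "\<And>i. i \<in> I \<Longrightarrow> A i \<in> events"
    and ind: "\<And>i j. i \<in> I \<Longrightarrow> j \<in> I \<Longrightarrow> i \<noteq> j \<Longrightarrow> prob (A i \<inter> A j) = prob (A i) * prob (A j)"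
    and pos: "0 < (\<Sum>i\<in>I. prob (A i))"
  shows "prob {\<omega> \<in> space M. \<forall>i\<in>I. \<omega> \<notin> A i} \<le> 1 / (\<Sum>i\<in>I. prob (A i))"
proof -
  define S where "S = (\<Sum>i\<in>I. prob (A i))"
  define X where "X \<omega> = (\<Sum>i\<in>I. indicator (A i) \<omega> :: real)" for \<omega>
  have [measurable]: "A i \<in> events" if "i \<in> I" for i using A that .
  have X[measurable]: "X \<in> borel_measurable M" unfolding X_def by measurable
  have X2: "(X \<omega>)\<^sup>2 = (\<Sum>i\<in>I. \<Sum>j\<in>I. indicator (A i \<inter> A j) \<omega>)" for \<omega>
    by (simp add: X_def power2_eq_square sum_product indicator_inter_arith)
  have int: "integrable M (indicator B :: 'a \<Rightarrow> real)" if "B \<in> events" for B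
    using that by (simp add: integrable_indicator_iff emeasure_eq_measure)
  have EX: "expectation X = S"
    unfolding X_def S_def using A by (subst Bochner_Integration.integral_sum) (auto intro!: int sum.cong)
  have intX2: "integrable M (\<lambda>\<omega>. (X \<omega>)\<^sup>2)"
    unfolding X2 using A by (intro Bochner_Integration.integrable_sum int) auto
  have "expectation (\<lambda>\<omega>. (X \<omega>)\<^sup>2) = (\<Sum>i\<in>I. \<Sum>j\<in>I. prob (A i \<inter> A j))"
    unfolding X2 using A
    by (subst Bochner_Integration.integral_sum; (intro sum.cong refl)?)
       (auto intro!: int Bochner_Integration.integrable_sum sum.cong simp: Bochner_Integration.integral_sum[OF int])
  also have "\<dots> \<le> (\<Sum>i\<in>I. \<Sum>j\<in>I. prob (A i) * prob (A j) + (if i = j then prob (A i) else 0))"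
    using ind by (intro sum_mono) auto
  also have "\<dots> = S\<^sup>2 + S"
    using I by (simp add: sum.distrib S_def power2_eq_square sum_product)
  finally have EX2: "expectation (\<lambda>\<omega>. (X \<omega>)\<^sup>2) \<le> S\<^sup>2 + S" .
  have intX: "integrable M X"
    unfolding X_def using A by (intro Bochner_Integration.integrable_sum int) auto
  have "variance X = expectation (\<lambda>\<omega>. (X \<omega>)\<^sup>2) - S\<^sup>2"
    using variance_eq[OF intX intX2] EX by simp
  then have var: "variance X \<le> S" using EX2 by simp
  have S: "0 < S" using pos by (simp add: S_def)
  have "prob {\<omega> \<in> space M. \<forall>i\<in>I. \<omega> \<notin> A i} \<le> prob {\<omega> \<in> space M. S \<le> \<bar>X \<omega> - expectation X\<bar>}"
    using S by (intro finite_measure_mono) (auto simp: X_def EX)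
  also have "\<dots> \<le> variance X / S\<^sup>2"
    by (rule Chebyshev_inequality[OF X intX2 S])
  also have "\<dots> \<le> S / S\<^sup>2" using var by (intro divide_right_mono) auto
  also have "\<dots> = 1 / S" using S by (simp add: power2_eq_square)
  finally show ?thesis by (simp add: S_def)
qed

text \<open>
  A form of the second Borel--Cantelli lemma for merely pairwise independent events: finite subfamilies with
  large total probability bound the probability that none of the events occurs by \<open>1 / C\<close>, for every \<open>C > 0\<close>.
\<close>
lemma (in prob_space) AE_pairwise_indep_event_occurs:
  assumes "countable I" and A: "\<And>i. i \<in> I \<Longrightarrow> A i \<in> events"
    and ind: "\<And>i j. i \<in> I \<Longrightarrow> j \<in> I \<Longrightarrow> i \<noteq> j \<Longrightarrow> prob (A i \<inter> A j) = prob (A i) * prob (A j)"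
    and div: "\<And>C::real. \<exists>F\<subseteq>I. finite F \<and> C \<le> (\<Sum>i\<in>F. prob (A i))"
  shows "AE \<omega> in M. \<exists>i\<in>I. \<omega> \<in> A i"
proof -
  let ?N = "\<lambda>F. {\<omega> \<in> space M. \<forall>i\<in>F. \<omega> \<notin> A i}"
  have meas: "?N F \<in> events" if "F \<subseteq> I" for F
  proof -
    have [measurable]: "A i \<in> events" if "i \<in> F" for i using A \<open>F \<subseteq> I\<close> that by auto
    have "countable F" using assms(1) that countable_subset by blast
    then show ?thesis by measurable
  qed
  have "prob (?N I) \<le> 1 / C" if "0 < C" for C :: real
  proof -
    obtain F where F: "F \<subseteq> I" "finite F" "C \<le> (\<Sum>i\<in>F. prob (A i))" using div by blast
    have "prob (?N I) \<le> prob (?N F)" using F meas by (intro finite_measure_mono) auto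
    also have "\<dots> \<le> 1 / (\<Sum>i\<in>F. prob (A i))"
    proof (rule prob_no_pairwise_indep_event_le)
      show "prob (A i \<inter> A j) = prob (A i) * prob (A j)" if "i \<in> F" "j \<in> F" "i \<noteq> j" for i j
        using that F(1) by (intro ind) auto
    qed (use F A that in auto)
    also have "\<dots> \<le> 1 / C" using F that by (intro divide_left_mono mult_pos_pos) auto
    finally show ?thesis .
  qed
  \<comment> \<open>a positive probability \<open>p\<close> would contradict the bound for \<open>C = 2 / p\<close>\<close>
  from this[of "2 / prob (?N I)"] have "prob (?N I) \<le> 0"
    by (cases "0 < prob (?N I)") (auto simp: field_simps)
  then have "prob (?N I) = 0" using measure_nonneg[of M "?N I"] by simp
  then have "AE \<omega> in M. \<omega> \<notin> ?N I"
    using meas[of I] by (simp add: AE_iff_measurable[of "?N I"] emeasure_eq_measure)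
  then show ?thesis by (rule AE_mp) auto
qed

text \<open>
  Fubini for an index \<open>v\<close> that occurs in only one of two conditions: given all other angles, the
  probability of the condition on \<open>v\<close> is computed with these angles held fixed. Indices among \<open>i\<close>, \<open>j\<close>, \<open>u\<close>
  may coincide, so the two conditions may share an angle.
\<close>
lemma (in prob_space) emeasure_fresh_coordinate:
  fixes \<theta> :: "'i \<Rightarrow> 'a \<Rightarrow> real"
  assumes ind: "indep_vars (\<lambda>_. borel) \<theta> UNIV" and v: "v \<notin> {i, j, u}"
    and E[measurable]: "E \<in> sets (borel \<Otimes>\<^sub>M borel)" and B[measurable]: "B \<in> sets (borel \<Otimes>\<^sub>M borel)"
  shows "emeasure M {\<omega> \<in> space M. (\<theta> i \<omega>, \<theta> j \<omega>) \<in> E \<and> (\<theta> u \<omega>, \<theta> v \<omega>) \<in> B}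
    = (\<integral>\<^sup>+\<omega>. indicator E (\<theta> i \<omega>, \<theta> j \<omega>) * emeasure (distr M borel (\<theta> v)) (Pair (\<theta> u \<omega>) -` B) \<partial>M)"
proof -
  \<comment> \<open>all angles other than the fresh one that occur in the two conditions\<close>
  define J where "J = {i, j, u}"
  define PJ where "PJ = Pi\<^sub>M J (\<lambda>_. borel :: real measure)"
  define X where "X \<omega> = (\<lambda>x\<in>J. \<theta> x \<omega>)" for \<omega>
  have [measurable]: "\<theta> x \<in> borel_measurable M" for x
    using ind by (auto simp: indep_vars_def)
  have X[measurable]: "X \<in> measurable M PJ"
    unfolding X_def PJ_def by measurable
  have [measurable]: "(\<lambda>f. f x) \<in> measurable PJ borel" if "x \<in> J" for x
    unfolding PJ_def using that by (rule measurable_component_singleton)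
  have iJ: "i \<in> J" "j \<in> J" "u \<in> J" by (auto simp: J_def)
  note [measurable] = this
  define PV where "PV = Pi\<^sub>M {v} (\<lambda>_. borel :: real measure)"
  define Y where "Y \<omega> = (\<lambda>x\<in>{v}. \<theta> x \<omega>)" for \<omega>
  have Y[measurable]: "Y \<in> measurable M PV"
    unfolding Y_def PV_def by measurable
  have [measurable]: "(\<lambda>f. f v) \<in> measurable PV borel"
    unfolding PV_def by (rule measurable_component_singleton) simp
  have "indep_var PJ X PV Y"
    unfolding PJ_def PV_def X_def Y_def by (rule indep_var_restrict[OF ind]) (use v in \<open>auto simp: J_def\<close>)
  then have joint: "distr M PJ X \<Otimes>\<^sub>M distr M PV Y = distr M (PJ \<Otimes>\<^sub>M PV) (\<lambda>\<omega>. (X \<omega>, Y \<omega>))"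
    by (simp add: indep_var_distribution_eq)
  define T where "T = {p \<in> space (PJ \<Otimes>\<^sub>M PV). (fst p i, fst p j) \<in> E \<and> (fst p u, snd p v) \<in> B}"
  have T[measurable]: "T \<in> sets (PJ \<Otimes>\<^sub>M PV)"
    unfolding T_def by measurable
  interpret V: prob_space "distr M PV Y" by (rule prob_space_distr) simp
  have slice: "emeasure (distr M PV Y) (Pair (X \<omega>) -` T)
      = indicator E (\<theta> i \<omega>, \<theta> j \<omega>) * emeasure (distr M borel (\<theta> v)) (Pair (\<theta> u \<omega>) -` B)"
    if \<omega>: "\<omega> \<in> space M" for \<omega>
  proof -
    have "emeasure (distr M PV Y) (Pair (X \<omega>) -` T) = emeasure M (Y -` (Pair (X \<omega>) -` T) \<inter> space M)"
      by (rule emeasure_distr) (auto intro: sets_Pair1)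
    also have "Y -` (Pair (X \<omega>) -` T) \<inter> space M
        = (if (\<theta> i \<omega>, \<theta> j \<omega>) \<in> E then \<theta> v -` (Pair (\<theta> u \<omega>) -` B) \<inter> space M else {})"
      using measurable_space[OF X \<omega>] measurable_space[OF Y] iJ
      by (auto simp: T_def X_def Y_def space_pair_measure)
    also have "emeasure M (if (\<theta> i \<omega>, \<theta> j \<omega>) \<in> E then \<theta> v -` (Pair (\<theta> u \<omega>) -` B) \<inter> space M else {})
        = indicator E (\<theta> i \<omega>, \<theta> j \<omega>) * emeasure (distr M borel (\<theta> v)) (Pair (\<theta> u \<omega>) -` B)"
      by (subst emeasure_distr) (auto intro: sets_Pair1)
    finally show ?thesis .
  qed
  have "{\<omega> \<in> space M. (\<theta> i \<omega>, \<theta> j \<omega>) \<in> E \<and> (\<theta> u \<omega>, \<theta> v \<omega>) \<in> B}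
      = (\<lambda>\<omega>. (X \<omega>, Y \<omega>)) -` T \<inter> space M"
    using measurable_space[OF X] measurable_space[OF Y] iJ
    by (auto simp: T_def X_def Y_def space_pair_measure)
  then have "emeasure M {\<omega> \<in> space M. (\<theta> i \<omega>, \<theta> j \<omega>) \<in> E \<and> (\<theta> u \<omega>, \<theta> v \<omega>) \<in> B}
      = emeasure (distr M PJ X \<Otimes>\<^sub>M distr M PV Y) T"
    unfolding joint by (subst emeasure_distr) auto
  also have "\<dots> = (\<integral>\<^sup>+f. emeasure (distr M PV Y) (Pair f -` T) \<partial>distr M PJ X)"
    by (rule V.emeasure_pair_measure_alt) simp
  also have "\<dots> = (\<integral>\<^sup>+\<omega>. emeasure (distr M PV Y) (Pair (X \<omega>) -` T) \<partial>M)"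
    by (subst nn_integral_distr) (auto intro!: V.measurable_emeasure_Pair)
  also have "\<dots> = (\<integral>\<^sup>+\<omega>. indicator E (\<theta> i \<omega>, \<theta> j \<omega>) * emeasure (distr M borel (\<theta> v)) (Pair (\<theta> u \<omega>) -` B) \<partial>M)"
    by (intro nn_integral_cong slice)
  finally show ?thesis .
qed

text \<open>
  If the conditional probability is the same for almost every position of \<open>\<theta> u\<close>, the condition on the
  fresh index is independent of the other one.
\<close>
lemma (in prob_space) prob_fresh_coordinate_eq:
  fixes \<theta> :: "'i \<Rightarrow> 'a \<Rightarrow> real"
  assumes ind: "indep_vars (\<lambda>_. borel) \<theta> UNIV" and v: "v \<notin> {i, j, u}"
    and E[measurable]: "E \<in> sets (borel \<Otimes>\<^sub>M borel)" and B[measurable]: "B \<in> sets (borel \<Otimes>\<^sub>M borel)"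
    and p: "AE x in distr M borel (\<theta> u). emeasure (distr M borel (\<theta> v)) (Pair x -` B) = p"
  shows "emeasure M {\<omega> \<in> space M. (\<theta> i \<omega>, \<theta> j \<omega>) \<in> E \<and> (\<theta> u \<omega>, \<theta> v \<omega>) \<in> B}
    = p * emeasure M {\<omega> \<in> space M. (\<theta> i \<omega>, \<theta> j \<omega>) \<in> E}"
proof -
  have [measurable]: "\<theta> x \<in> borel_measurable M" for x
    using ind by (auto simp: indep_vars_def)
  have "AE \<omega> in M. emeasure (distr M borel (\<theta> v)) (Pair (\<theta> u \<omega>) -` B) = p"
    using AE_distrD[OF _ p] by simp
  then have "(\<integral>\<^sup>+\<omega>. indicator E (\<theta> i \<omega>, \<theta> j \<omega>) * emeasure (distr M borel (\<theta> v)) (Pair (\<theta> u \<omega>) -` B) \<partial>M)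
     = (\<integral>\<^sup>+\<omega>. p * indicator {\<omega> \<in> space M. (\<theta> i \<omega>, \<theta> j \<omega>) \<in> E} \<omega> \<partial>M)"
    by (intro nn_integral_cong_AE) (auto elim!: AE_mp simp: indicator_def)
  also have "\<dots> = p * emeasure M {\<omega> \<in> space M. (\<theta> i \<omega>, \<theta> j \<omega>) \<in> E}"
    by (subst nn_integral_cmult) auto
  finally show ?thesis
    using emeasure_fresh_coordinate[OF ind v E B] by simp
qed

lemma (in prob_space) prob_fresh_coordinate_le:
  fixes \<theta> :: "'i \<Rightarrow> 'a \<Rightarrow> real"
  assumes ind: "indep_vars (\<lambda>_. borel) \<theta> UNIV" and v: "v \<noteq> u"
    and B[measurable]: "B \<in> sets (borel \<Otimes>\<^sub>M borel)"
    and p: "\<And>x. emeasure (distr M borel (\<theta> v)) (Pair x -` B) \<le> p"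
  shows "emeasure M {\<omega> \<in> space M. (\<theta> u \<omega>, \<theta> v \<omega>) \<in> B} \<le> p"
proof -
  have "emeasure M {\<omega> \<in> space M. (\<theta> u \<omega>, \<theta> v \<omega>) \<in> B}
    = (\<integral>\<^sup>+\<omega>. emeasure (distr M borel (\<theta> v)) (Pair (\<theta> u \<omega>) -` B) \<partial>M)"
    using emeasure_fresh_coordinate[OF ind, of v u u u UNIV B] v sets.top[of "borel \<Otimes>\<^sub>M borel :: (real \<times> real) measure"]
    by (simp add: space_pair_measure)
  also have "\<dots> \<le> (\<integral>\<^sup>+\<omega>. p \<partial>M)" by (intro nn_integral_mono p)
  also have "\<dots> = p" by (simp add: emeasure_space_1)
  finally show ?thesis .
qed

lemma abs_sin_ge_half:
  fixes y :: real
  assumes "\<bar>y\<bar> \<le> pi / 2"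
  shows "\<bar>y\<bar> / 2 \<le> \<bar>sin y\<bar>"
proof -
  define x where "x = \<bar>y\<bar>"
  have x: "0 \<le> x" "x \<le> pi / 2" using assms by (auto simp: x_def)
  have "x / 2 \<le> sin x"
  proof (cases "x \<le> pi / 3")
    case True
    have "sin 0 - 0 / 2 \<le> sin x - x / 2"
    proof (rule DERIV_nonneg_imp_nondecreasing[OF x(1)])
      fix t assume t: "0 \<le> t" "t \<le> x"
      have "cos (pi / 3) \<le> cos t" using t True by (intro cos_monotone_0_pi_le) auto
      then have "0 \<le> cos t - 1 / 2" by (simp add: cos_60)
      moreover have "((\<lambda>t. sin t - t / 2) has_real_derivative cos t - 1 / 2) (at t)"
        by (auto intro!: derivative_eq_intros)
      ultimately show "\<exists>d. ((\<lambda>t. sin t - t / 2) has_real_derivative d) (at t) \<and> 0 \<le> d" by blast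
    qed
    then show ?thesis by simp
  next
    case False
    have "sin (pi / 3) \<le> sin x" using x False by (intro sin_monotone_2pi_le) auto
    moreover have "(17/10 :: real) \<le> sqrt 3" by (rule real_le_rsqrt) (simp add: power2_eq_square)
    moreover have "pi \<le> 3.2" using pi_approx by simp
    ultimately show ?thesis using x by (simp add: sin_60)
  qed
  moreover have "sin x = \<bar>sin y\<bar>"
    using x sin_ge_zero[of x] by (cases "0 \<le> y") (auto simp: x_def)
  ultimately show ?thesis by (simp add: x_def)
qed

lemma abs_sin_add_int_pi: "\<bar>sin (y + of_int k * pi)\<bar> = \<bar>sin y\<bar>"
proof -
  have s: "sin (of_int k * pi) = 0" by (auto simp: sin_zero_iff_int2)
  have "(cos (of_int k * pi))\<^sup>2 = 1"
    using sin_cos_squared_add[of "of_int k * pi"] s by simp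
  then have "\<bar>cos (of_int k * pi)\<bar> = 1" by (auto simp: power2_eq_1_iff)
  then show ?thesis using s by (simp add: sin_add abs_mult)
qed

text \<open>
  Where \<open>\<bar>sin\<bar> < e\<close>, the argument is within \<open>2 e\<close> of a multiple of \<open>pi\<close>. As \<open>v\<close> runs through an interval of length
  \<open>2 pi\<close>, at most three such multiples are relevant.
\<close>
lemma emeasure_abs_sin_less:
  assumes "0 \<le> e"
  shows "emeasure lborel ({0..2*pi} \<inter> {v. \<bar>sin (v - u)\<bar> < e}) \<le> ennreal (12 * e)"
proof -
  define K where "K = \<lfloor>- u / pi + 1/2\<rfloor>"
  have sub: "{0..2*pi} \<inter> {v. \<bar>sin (v - u)\<bar> < e}
    \<subseteq> (\<Union>k\<in>{K..K+2}. {u + of_int k * pi - 2 * e .. u + of_int k * pi + 2 * e})"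
  proof
    fix v assume v: "v \<in> {0..2*pi} \<inter> {v. \<bar>sin (v - u)\<bar> < e}"
    define k where "k = \<lfloor>(v - u) / pi + 1/2\<rfloor>"
    have "K \<le> k" unfolding K_def k_def using v divide_right_mono[of "- u" "v - u" pi] by (intro floor_mono) auto
    moreover have "k \<le> \<lfloor>- u / pi + 1/2 + 2\<rfloor>"
      unfolding k_def using v by (intro floor_mono) (simp add: field_simps)
    moreover have "\<lfloor>- u / pi + 1/2 + 2\<rfloor> = K + 2"
      unfolding K_def by (metis floor_add_int of_int_numeral)
    ultimately have k: "k \<in> {K..K+2}" by simp
    define y where "y = v - u - of_int k * pi"
    have "of_int k \<le> (v - u) / pi + 1/2" "(v - u) / pi + 1/2 < of_int k + 1"
      unfolding k_def by linarith+
    then have "y \<le> pi / 2" "- y \<le> pi / 2" by (simp_all add: y_def field_simps)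
    then have "\<bar>y\<bar> \<le> pi / 2" by linarith
    then have "\<bar>y\<bar> / 2 \<le> \<bar>sin y\<bar>" by (rule abs_sin_ge_half)
    also have "\<bar>sin y\<bar> = \<bar>sin (v - u)\<bar>"
      using abs_sin_add_int_pi[of y k] by (simp add: y_def)
    also have "\<dots> < e" using v by simp
    finally have "v \<in> {u + of_int k * pi - 2 * e .. u + of_int k * pi + 2 * e}"
      by (auto simp: y_def abs_less_iff)
    then show "v \<in> (\<Union>k\<in>{K..K+2}. {u + of_int k * pi - 2 * e .. u + of_int k * pi + 2 * e})"
      using k by blast
  qed
  have "emeasure lborel ({0..2*pi} \<inter> {v. \<bar>sin (v - u)\<bar> < e})
    \<le> emeasure lborel (\<Union>k\<in>{K..K+2}. {u + of_int k * pi - 2 * e .. u + of_int k * pi + 2 * e})"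
    by (rule emeasure_mono[OF sub]) auto
  also have "\<dots> \<le> (\<Sum>k\<in>{K..K+2}. emeasure lborel {u + of_int k * pi - 2 * e .. u + of_int k * pi + 2 * e})"
    by (rule emeasure_subadditive_finite) auto
  also have "\<dots> = (\<Sum>k\<in>{K..K+2}. ennreal (4 * e))"
    using assms by (intro sum.cong) auto
  also have "\<dots> = ennreal (\<Sum>k\<in>{K..K+2}. 4 * e)"
    using assms by (intro sum_ennreal) auto
  also have "(\<Sum>k\<in>{K..K+2}. 4 * e) = 12 * e" by simp
  finally show ?thesis .
qed

lemma emeasure_uniform_angle:
  assumes "S \<in> sets borel"
  shows "emeasure (uniform_measure lborel {0..2*pi}) S = emeasure lborel ({0..2*pi} \<inter> S) / ennreal (2*pi)"
  using assms by (subst emeasure_uniform_measure) auto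

lemma emeasure_uniform_abs_sin_less:
  assumes "0 \<le> e"
  shows "emeasure (uniform_measure lborel {0..2*pi}) {v. \<bar>sin (v - u)\<bar> < e} \<le> ennreal (2 * e)"
proof -
  have "emeasure (uniform_measure lborel {0..2*pi}) {v. \<bar>sin (v - u)\<bar> < e}
      \<le> ennreal (12 * e) / ennreal (2 * pi)"
    using emeasure_abs_sin_less[OF assms]
    by (subst emeasure_uniform_angle) (auto intro!: divide_right_mono_ennreal)
  also have "\<dots> = ennreal (12 * e / (2 * pi))" using assms by (intro divide_ennreal) auto
  also have "\<dots> \<le> ennreal (2 * e)"
  proof (rule ennreal_leI)
    have "e * 3 \<le> e * pi" using assms pi_gt3 by (intro mult_left_mono) auto
    then show "12 * e / (2 * pi) \<le> 2 * e" by (simp add: field_simps)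
  qed
  finally show ?thesis .
qed

text \<open>
  The number of the arc that contains the angle \<open>x\<close> when the circle is cut into \<open>m\<close> arcs of equal length.
\<close>
definition box_index :: "nat \<Rightarrow> real \<Rightarrow> int" where
  "box_index m x = \<lfloor>real m * x / (2 * pi)\<rfloor>"

lemma box_index_measurable[measurable]: "box_index m \<in> measurable borel (count_space UNIV)"
  unfolding box_index_def by measurable

lemma abs_diff_le_of_same_box:
  assumes "0 < m" "box_index m x = box_index m y"
  shows "\<bar>x - y\<bar> \<le> 2 * pi / real m"
proof -
  have "\<bar>real m * x / (2 * pi) - real m * y / (2 * pi)\<bar> < 1"
    using assms unfolding box_index_def by linarith
  also have "real m * x / (2 * pi) - real m * y / (2 * pi) = real m * (x - y) / (2 * pi)"
    by (simp add: diff_divide_distrib right_diff_distrib)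
  finally have "\<bar>real m * (x - y)\<bar> < 2 * pi" by (simp add: abs_mult)
  then have "\<bar>x - y\<bar> * real m \<le> 2 * pi" by (simp add: abs_mult mult.commute)
  then show ?thesis using assms(1) by (simp add: pos_le_divide_eq)
qed

lemma emeasure_same_box:
  assumes "0 < m" "0 \<le> x" "x < 2 * pi"
  shows "emeasure (uniform_measure lborel {0..2*pi}) {y. box_index m x = box_index m y} = ennreal (1 / real m)"
proof -
  define b where "b = box_index m x"
  have b: "0 \<le> b" "b + 1 \<le> int m"
  proof -
    show "0 \<le> b" using assms by (simp add: b_def box_index_def)
    have "real m * x / (2 * pi) < real m" using assms by (simp add: field_simps)
    then have "b < int m" unfolding b_def box_index_def by (simp add: floor_less_iff)
    then show "b + 1 \<le> int m" by simp
  qed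
  let ?l = "2 * pi * of_int b / real m" and ?r = "2 * pi * (of_int b + 1) / real m"
  have "b = box_index m y \<longleftrightarrow> ?l \<le> y \<and> y < ?r" for y
  proof -
    have "b = box_index m y \<longleftrightarrow> of_int b \<le> real m * y / (2 * pi) \<and> real m * y / (2 * pi) < of_int b + 1"
      unfolding box_index_def by linarith
    then show ?thesis using assms(1) by (simp add: field_simps)
  qed
  moreover have "0 \<le> ?l" using b assms(1) by simp
  moreover have "?r \<le> 2 * pi"
  proof -
    have "of_int b + 1 \<le> real m" using b(2) by linarith
    then have "2 * pi * (of_int b + 1) \<le> 2 * pi * real m" by (intro mult_left_mono) auto
    then show ?thesis using assms(1) by (simp only: pos_divide_le_eq of_nat_0_less_iff)
  qed
  ultimately have "{0..2*pi} \<inter> {y. b = box_index m y} = {?l..<?r}" by fastforce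
  moreover have "?l \<le> ?r" using assms(1) by (simp add: field_simps)
  moreover have "?r - ?l = 2 * pi / real m" by (simp add: diff_divide_distrib[symmetric] algebra_simps)
  ultimately have e: "emeasure lborel ({0..2*pi} \<inter> {y. b = box_index m y}) = ennreal (2 * pi / real m)"
    by simp
  have "emeasure (uniform_measure lborel {0..2*pi}) {y. b = box_index m y}
      = ennreal (2 * pi / real m) / ennreal (2 * pi)"
    by (subst emeasure_uniform_angle) (auto simp: e)
  also have "\<dots> = ennreal (1 / real m)" by (subst divide_ennreal) auto
  finally show ?thesis unfolding b_def .
qed

text \<open>
  The endpoint \<open>2 pi\<close> lies in a box of its own, hence the exceptional null set.
\<close>
lemma AE_emeasure_same_box:
  assumes "0 < m"
  shows "AE x in uniform_measure lborel {0..2*pi}.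
    emeasure (uniform_measure lborel {0..2*pi}) {y. box_index m x = box_index m y} = ennreal (1 / real m)"
proof -
  have "AE x in lborel. x \<noteq> 2 * pi" by (rule AE_lborel_singleton)
  then have "AE x in lborel. x \<in> {0..2*pi} \<longrightarrow>
    emeasure (uniform_measure lborel {0..2*pi}) {y. box_index m x = box_index m y} = ennreal (1 / real m)"
    by (rule AE_mp) (use emeasure_same_box[OF assms] in \<open>auto intro!: AE_I2\<close>)
  then show ?thesis by (intro AE_uniform_measureI) auto
qed

section \<open>The random point set\<close>

text \<open>
  Countably many conditions on pairs: this form gives measurability of the separation event, and it is
  the one in which separation is proved and refuted.
\<close>
lemma D_separated_range_iff:
  "D_separated (range f) \<longleftrightarrow>
    (\<exists>n::nat. \<forall>j k. f j \<noteq> f k \<longrightarrow> 1 / (real n + 2) \<le> rho_D (f j) (f k))"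
proof
  assume "D_separated (range f)"
  then obtain d :: real where d: "0 < d" "d < 1"
    and inf: "ereal d < (INF (z, w)\<in>{(z, w). z \<in> range f \<and> w \<in> range f \<and> z \<noteq> w}. ereal (rho_D z w))"
    unfolding D_separated_def by blast
  obtain n where n: "inverse (real (Suc n)) < d" using reals_Archimedean[OF d(1)] by blast
  have "1 / (real n + 2) \<le> rho_D (f j) (f k)" if "f j \<noteq> f k" for j k
  proof -
    have "(INF (z, w)\<in>{(z, w). z \<in> range f \<and> w \<in> range f \<and> z \<noteq> w}. ereal (rho_D z w)) \<le> ereal (rho_D (f j) (f k))"
      by (rule INF_lower2[of "(f j, f k)"]) (use that in auto)
    from less_le_trans[OF inf this] have "d < rho_D (f j) (f k)" by simp
    moreover have "1 / (real n + 2) \<le> inverse (real (Suc n))" by (simp add: field_simps)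
    ultimately show ?thesis using n by linarith
  qed
  then show "\<exists>n::nat. \<forall>j k. f j \<noteq> f k \<longrightarrow> 1 / (real n + 2) \<le> rho_D (f j) (f k)" by blast
next
  assume "\<exists>n::nat. \<forall>j k. f j \<noteq> f k \<longrightarrow> 1 / (real n + 2) \<le> rho_D (f j) (f k)"
  then obtain n :: nat where n: "\<And>j k. f j \<noteq> f k \<Longrightarrow> 1 / (real n + 2) \<le> rho_D (f j) (f k)" by blast
  have "ereal (1 / (real n + 3)) < ereal (1 / (real n + 2))" by (simp add: field_simps)
  also have "\<dots> \<le> (INF (z, w)\<in>{(z, w). z \<in> range f \<and> w \<in> range f \<and> z \<noteq> w}. ereal (rho_D z w))"
    using n by (intro INF_greatest) auto
  finally show "D_separated (range f)"
    unfolding D_separated_def by (intro exI[of _ "1 / (real n + 3)"]) auto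
qed

lemma cnj_rcis_mult_rcis: "cnj (rcis s b) * rcis r a = rcis (r * s) (a - b)"
  by (simp add: rcis_def cis_cnj cis_mult mult_ac)

text \<open>
  The distance from \<open>1\<close> to the line through \<open>0\<close> in direction \<open>t\<close> is \<open>\<bar>sin t\<bar>\<close>; in particular the bound
  is uniform in the radius.
\<close>
lemma abs_sin_le_norm_one_minus_rcis: "\<bar>sin t\<bar> \<le> cmod (1 - rcis r t)"
proof -
  have "(cmod (1 - rcis r t))\<^sup>2 = (1 - r * cos t)\<^sup>2 + (r * sin t)\<^sup>2"
    by (simp add: cmod_power2)
  also have "\<dots> = (r - cos t)\<^sup>2 + (sin t)\<^sup>2 + (r\<^sup>2 - 1) * ((sin t)\<^sup>2 + (cos t)\<^sup>2 - 1)"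
    by algebra
  also have "\<dots> = (r - cos t)\<^sup>2 + (sin t)\<^sup>2" by simp
  finally have "(sin t)\<^sup>2 \<le> (cmod (1 - rcis r t))\<^sup>2" by simp
  then show ?thesis by (simp add: power2_le_iff_abs_le)
qed

locale random_angles = prob_space M for M :: "'a measure" +
  fixes \<rho> :: "nat \<Rightarrow> real" and \<theta> :: "nat \<Rightarrow> 'a \<Rightarrow> real"
  assumes radius: "0 \<le> \<rho> k" "\<rho> k < 1"
    and indep: "indep_vars (\<lambda>_. borel) \<theta> UNIV"
    and angle_distr: "distr M borel (\<theta> k) = uniform_measure lborel {0..2 * pi}"
begin

definition pt :: "nat \<Rightarrow> 'a \<Rightarrow> complex" where
  "pt k \<omega> = rcis (\<rho> k) (\<theta> k \<omega>)"

lemma random_points_eq: "random_points \<rho> \<theta> \<omega> = range (\<lambda>k. pt k \<omega>)"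
  by (simp add: random_points_def pt_def)

lemma norm_pt[simp]: "cmod (pt k \<omega>) = \<rho> k"
  using radius[of k] by (simp add: pt_def)

lemma angle_measurable[measurable]: "\<theta> k \<in> borel_measurable M"
  using indep by (auto simp: indep_vars_def)

lemma pt_measurable[measurable]: "pt k \<in> borel_measurable M"
proof -
  have "cis \<in> borel_measurable borel" by (intro borel_measurable_continuous_onI continuous_on_cis continuous_on_id)
  note [measurable] = this
  show ?thesis unfolding pt_def rcis_def by measurable
qed

lemma rho_D_measurable[measurable]: "(\<lambda>\<omega>. rho_D (pt j \<omega>) (pt k \<omega>)) \<in> borel_measurable M"
proof -
  have "cnj \<in> borel_measurable borel" by (intro borel_measurable_continuous_onI continuous_intros)
  note [measurable] = this
  show ?thesis unfolding rho_D_def dirichlet_kernel_def by measurable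
qed

lemma D_separated_event: "{\<omega> \<in> space M. D_separated (random_points \<rho> \<theta> \<omega>)} \<in> sets M"
  unfolding random_points_eq D_separated_range_iff by measurable

lemma prob_abs_sin_less:
  assumes "j \<noteq> k" "0 \<le> e"
  shows "prob {\<omega> \<in> space M. \<bar>sin (\<theta> k \<omega> - \<theta> j \<omega>)\<bar> < e} \<le> 2 * e"
proof -
  let ?B = "{p :: real \<times> real. \<bar>sin (snd p - fst p)\<bar> < e}"
  have B: "?B \<in> sets (borel \<Otimes>\<^sub>M borel)"
  proof -
    have "(\<lambda>p :: real \<times> real. \<bar>sin (snd p - fst p)\<bar>) \<in> borel_measurable (borel \<Otimes>\<^sub>M borel)" by measurable
    from measurable_sets[OF this, of "{..<e}"] show ?thesis
      by (simp add: vimage_def space_pair_measure)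
  qed
  have "emeasure M {\<omega> \<in> space M. (\<theta> j \<omega>, \<theta> k \<omega>) \<in> ?B} \<le> ennreal (2 * e)"
  proof (rule prob_fresh_coordinate_le[OF indep _ B])
    show "emeasure (distr M borel (\<theta> k)) (Pair x -` ?B) \<le> ennreal (2 * e)" for x
      using emeasure_uniform_abs_sin_less[OF assms(2), of x] by (simp add: angle_distr vimage_def)
  qed (use assms in auto)
  then show ?thesis using assms(2) by (simp add: emeasure_eq_measure)
qed

text \<open>
  Points with radius \<open>0\<close> all coincide, so distinctness can only be claimed for positive radii.
\<close>
lemma AE_points_distinct:
  "AE \<omega> in M. \<forall>j k. j \<noteq> k \<and> 0 < \<rho> j \<longrightarrow> pt j \<omega> \<noteq> pt k \<omega>"
proof -
  have "AE \<omega> in M. sin (\<theta> k \<omega> - \<theta> j \<omega>) \<noteq> 0" if "j \<noteq> k" for j k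
  proof -
    let ?Z = "{\<omega> \<in> space M. sin (\<theta> k \<omega> - \<theta> j \<omega>) = 0}"
    have "prob ?Z \<le> 2 * e" if "0 < e" for e
    proof -
      have "prob ?Z \<le> prob {\<omega> \<in> space M. \<bar>sin (\<theta> k \<omega> - \<theta> j \<omega>)\<bar> < e}"
        using that by (intro finite_measure_mono) auto
      also have "\<dots> \<le> 2 * e" using prob_abs_sin_less[OF \<open>j \<noteq> k\<close>] that by simp
      finally show ?thesis .
    qed
    from this[of "prob ?Z / 4"] have "prob ?Z \<le> 0" by (cases "0 < prob ?Z") auto
    then have "prob ?Z = 0" using measure_nonneg[of M ?Z] by simp
    then show ?thesis by (simp add: AE_iff_measurable[of ?Z] emeasure_eq_measure)
  qed
  then have "AE \<omega> in M. \<forall>j k. j \<noteq> k \<longrightarrow> sin (\<theta> k \<omega> - \<theta> j \<omega>) \<noteq> 0"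
    by (simp add: AE_all_countable)
  then show ?thesis
  proof (rule AE_mp, intro AE_I2 impI allI)
    fix \<omega> j k
    assume s: "\<forall>j k. j \<noteq> k \<longrightarrow> sin (\<theta> k \<omega> - \<theta> j \<omega>) \<noteq> 0" and jk: "j \<noteq> k \<and> 0 < \<rho> j"
    show "pt j \<omega> \<noteq> pt k \<omega>"
    proof
      assume eq: "pt j \<omega> = pt k \<omega>"
      then have "\<rho> j = \<rho> k" by (metis norm_pt)
      have "cnj (pt j \<omega>) * pt k \<omega> = of_real ((cmod (pt j \<omega>))\<^sup>2)"
        unfolding eq by (metis complex_norm_square mult.commute)
      then have "rcis (\<rho> k * \<rho> j) (\<theta> k \<omega> - \<theta> j \<omega>) = of_real ((\<rho> j)\<^sup>2)"
        by (simp add: pt_def cnj_rcis_mult_rcis del: of_real_power)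
      then have "\<rho> k * \<rho> j * sin (\<theta> k \<omega> - \<theta> j \<omega>) = 0"
        by (metis Im_complex_of_real Im_rcis)
      then show False using s jk \<open>\<rho> j = \<rho> k\<close> by auto
    qed
  qed
qed

text \<open>
  The indices of the points in the \<open>n\<close>-th annulus, without those of the origin: for them, counting indices and
  counting points agree almost surely.
\<close>
definition level :: "nat \<Rightarrow> nat set" where
  "level n = {k. 0 < \<rho> k \<and> 1 - (1/2) ^ n \<le> \<rho> k \<and> \<rho> k < 1 - (1/2) ^ (n + 1)}"

lemma ex_level:
  assumes "0 < \<rho> k"
  shows "\<exists>n. k \<in> level n"
proof -
  obtain m where m: "(1/2) ^ m < 1 - \<rho> k"
    using real_arch_pow_inv[of "1 - \<rho> k" "1/2"] radius[of k] by auto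
  define m0 where "m0 = (LEAST m. (1/2 :: real) ^ m < 1 - \<rho> k)"
  have m0: "(1/2) ^ m0 < 1 - \<rho> k" unfolding m0_def by (rule LeastI[of _ m]) (rule m)
  have "m0 \<noteq> 0" using m0 radius[of k] by (intro notI) simp
  then obtain n where n: "m0 = Suc n" using not0_implies_Suc by blast
  have "\<not> (1/2) ^ n < 1 - \<rho> k" using not_less_Least[of n "\<lambda>m. (1/2 :: real) ^ m < 1 - \<rho> k"] n
    by (simp add: m0_def[symmetric])
  then have "k \<in> level n" using m0 assms by (auto simp: level_def n)
  then show ?thesis by blast
qed

lemma level_unique:
  assumes "k \<in> level m" "k \<in> level n"
  shows "m = n"
proof -
  have "\<not> a < b" if "k \<in> level a" "k \<in> level b" for a b
  proof
    assume "a < b"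
    then have "(1/2 :: real) ^ b \<le> (1/2) ^ (a + 1)" by (intro power_decreasing) auto
    then show False using that by (auto simp: level_def)
  qed
  then show ?thesis using assms by (meson linorder_neqE_nat)
qed

lemma card_level_le_annulus_count:
  assumes "\<forall>j k. j \<noteq> k \<and> 0 < \<rho> j \<longrightarrow> pt j \<omega> \<noteq> pt k \<omega>"
  shows "emeasure (count_space UNIV) (level n) \<le> annulus_count (random_points \<rho> \<theta> \<omega>) n"
proof -
  let ?S = "{z \<in> random_points \<rho> \<theta> \<omega>. 1 - (1/2) ^ n \<le> cmod z \<and> cmod z < 1 - (1/2) ^ (n + 1)}"
  have inj: "inj_on (\<lambda>k. pt k \<omega>) (level n)"
    using assms by (auto simp: inj_on_def level_def)
  have sub: "(\<lambda>k. pt k \<omega>) ` level n \<subseteq> ?S"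
    by (auto simp: random_points_eq level_def)
  show ?thesis
  proof (cases "finite (level n)")
    case True
    have "emeasure (count_space UNIV) (level n) = emeasure (count_space UNIV) ((\<lambda>k. pt k \<omega>) ` level n)"
      using True by (simp add: card_image[OF inj])
    also have "\<dots> \<le> annulus_count (random_points \<rho> \<theta> \<omega>) n"
      unfolding annulus_count_def by (rule emeasure_mono[OF sub]) simp
    finally show ?thesis .
  next
    case False
    then have "infinite ?S" using finite_imageD[OF _ inj] finite_subset[OF sub] by blast
    then have "annulus_count (random_points \<rho> \<theta> \<omega>) n = top"
      unfolding annulus_count_def by simp
    then show ?thesis by simp
  qed
qed

text \<open>
  The summand \<open>1\<close> accounts for the origin, which may occur in \<open>\<Lambda>\<close> (for infinitely many indices, but
  as one point).
\<close>
lemma annulus_count_le_card_level: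
  assumes "finite (level n)"
  shows "annulus_count (random_points \<rho> \<theta> \<omega>) n \<le> ennreal (real (card (level n)) + 1)"
proof -
  let ?T = "insert 0 ((\<lambda>k. pt k \<omega>) ` level n)"
  have *: "pt k \<omega> \<in> ?T" if "1 - (1/2) ^ n \<le> \<rho> k" "\<rho> k < 1 - (1/2) ^ (n + 1)" for k
    using that radius[of k] by (cases "\<rho> k = 0") (auto simp: level_def pt_def)
  then have "{z \<in> random_points \<rho> \<theta> \<omega>. 1 - (1/2) ^ n \<le> cmod z \<and> cmod z < 1 - (1/2) ^ (n + 1)} \<subseteq> ?T"
  proof (intro subsetI)
    fix z
    assume z: "z \<in> {z \<in> random_points \<rho> \<theta> \<omega>. 1 - (1/2) ^ n \<le> cmod z \<and> cmod z < 1 - (1/2) ^ (n + 1)}"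
    then obtain k where "z = pt k \<omega>" unfolding random_points_eq by blast
    then show "z \<in> ?T" using z * by simp
  qed
  then have "annulus_count (random_points \<rho> \<theta> \<omega>) n \<le> emeasure (count_space UNIV) ?T"
    unfolding annulus_count_def by (rule emeasure_mono) simp
  also have "\<dots> = ennreal (real (card ?T))" using assms by (simp add: ennreal_of_nat_eq_real_of_nat)
  also have "\<dots> \<le> ennreal (real (card (level n)) + 1)"
  proof (rule ennreal_leI)
    have "card ?T \<le> Suc (card ((\<lambda>k. pt k \<omega>) ` level n))" by (rule card_insert_le_m1) auto
    also have "\<dots> \<le> Suc (card (level n))" using card_image_le[OF assms] by simp
    finally show "real (card ?T) \<le> real (card (level n)) + 1" by simp
  qed
  finally show ?thesis .
qed

end

section \<open>Almost sure separation\<close>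

context random_angles
begin

text \<open>
  Points in the \<open>n\<close>-th annulus have weight of order \<open>2 powr (- g n / 2)\<close>, and there are at most
  \<open>O(2 powr (\<gamma> n / 2))\<close> of them, so the annuli contribute a geometric series.
\<close>
lemma summable_radius_weights:
  assumes fin: "\<And>n. finite (level n)"
    and bound: "\<And>n. (real (card (level n)))\<^sup>2 \<le> S * 2 powr (\<gamma> * real n)"
    and g: "0 < g" "\<gamma> < g" and g1: "g \<le> 2"
  shows "summable (\<lambda>k. if \<rho> k = 0 then 0 else (1 - (\<rho> k)\<^sup>2) powr (g / 2))"
proof -
  define f where "f k = (if \<rho> k = 0 then 0 else (1 - (\<rho> k)\<^sup>2) powr (g / 2))" for k
  have f0: "0 \<le> f k" for k by (simp add: f_def)
  have S: "0 \<le> S" using bound[of 0] by (auto intro: order_trans[OF zero_le_power2])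
  define q where "q = 2 powr ((\<gamma> - g) / 2)"
  have q: "0 < q" "q < 1" using g powr_less_cancel_iff[of 2 "(\<gamma> - g)/2" 0] by (auto simp: q_def)
  have f_le: "f k \<le> 2 * 2 powr (- (g / 2) * real n)" if "k \<in> level n" for k n
  proof -
    have k: "0 < \<rho> k" "1 - \<rho> k \<le> (1/2) ^ n" using that by (auto simp: level_def)
    have "1 - (\<rho> k)\<^sup>2 = (1 - \<rho> k) * (1 + \<rho> k)" by (simp add: power2_eq_square algebra_simps)
    also have "\<dots> \<le> (1/2) ^ n * 2" using k radius[of k] by (intro mult_mono) auto
    also have "\<dots> = 2 * 2 powr (- real n)"
      by (simp add: powr_minus powr_realpow power_one_over inverse_eq_divide)
    finally have "1 - (\<rho> k)\<^sup>2 \<le> 2 * 2 powr (- real n)" .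
    moreover have "0 \<le> 1 - (\<rho> k)\<^sup>2" using radius[of k] by (simp add: power_le_one)
    ultimately have "(1 - (\<rho> k)\<^sup>2) powr (g / 2) \<le> (2 * 2 powr (- real n)) powr (g / 2)"
      using g by (intro powr_mono2) auto
    also have "\<dots> = 2 powr (g / 2) * 2 powr (- (g / 2) * real n)"
      by (simp add: powr_mult powr_powr mult_ac)
    also have "\<dots> \<le> 2 powr 1 * 2 powr (- (g / 2) * real n)"
      using g1 by (intro mult_right_mono powr_mono) auto
    finally show ?thesis using k by (simp add: f_def)
  qed
  have level_sum: "real (card (level n)) * (2 * 2 powr (- (g / 2) * real n)) \<le> 2 * sqrt S * q ^ n" for n
  proof -
    have "real (card (level n)) \<le> sqrt (S * 2 powr (\<gamma> * real n))"
      using bound[of n] by (rule real_le_rsqrt)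
    also have "\<dots> = sqrt S * 2 powr (\<gamma> * real n / 2)"
      by (simp add: real_sqrt_mult powr_half_sqrt[symmetric] powr_powr)
    finally have "real (card (level n)) * (2 * 2 powr (- (g / 2) * real n))
        \<le> sqrt S * 2 powr (\<gamma> * real n / 2) * (2 * 2 powr (- (g / 2) * real n))"
      by (intro mult_right_mono) auto
    also have "\<dots> = 2 * sqrt S * (2 powr (\<gamma> * real n / 2) * 2 powr (- (g / 2) * real n))" by simp
    also have "2 powr (\<gamma> * real n / 2) * 2 powr (- (g / 2) * real n) = 2 powr ((\<gamma> - g) / 2 * real n)"
      by (simp add: powr_add[symmetric] field_simps)
    also have "\<dots> = q ^ n" using powr_realpow[of q n] q by (simp add: q_def powr_powr)
    finally show ?thesis .
  qed
  obtain lev where lev: "\<And>k. 0 < \<rho> k \<Longrightarrow> k \<in> level (lev k)" using ex_level by metis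
  have "sum f {..<N} \<le> 2 * sqrt S * (1 / (1 - q))" for N
  proof -
    define F where "F = {k \<in> {..<N}. 0 < \<rho> k}"
    have "sum f {..<N} = sum f F"
    proof (rule sum.mono_neutral_right)
      show "\<forall>k\<in>{..<N} - F. f k = 0"
      proof
        fix k assume "k \<in> {..<N} - F"
        then have "\<rho> k = 0" using radius[of k] by (auto simp: F_def)
        then show "f k = 0" by (simp add: f_def)
      qed
    qed (auto simp: F_def)
    also have "\<dots> = (\<Sum>n\<in>lev ` F. sum f {k \<in> F. lev k = n})"
      by (rule sum.image_gen) (simp add: F_def)
    also have "\<dots> \<le> (\<Sum>n\<in>lev ` F. 2 * sqrt S * q ^ n)"
    proof (rule sum_mono)
      fix n
      have sub: "{k \<in> F. lev k = n} \<subseteq> level n" using lev by (auto simp: F_def)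
      have "sum f {k \<in> F. lev k = n} \<le> (\<Sum>k\<in>{k \<in> F. lev k = n}. 2 * 2 powr (- (g / 2) * real n))"
        using sub by (intro sum_mono f_le) auto
      also have "\<dots> = real (card {k \<in> F. lev k = n}) * (2 * 2 powr (- (g / 2) * real n))" by simp
      also have "\<dots> \<le> real (card (level n)) * (2 * 2 powr (- (g / 2) * real n))"
        using card_mono[OF fin sub] by (intro mult_right_mono) auto
      also have "\<dots> \<le> 2 * sqrt S * q ^ n" by (rule level_sum)
      finally show "sum f {k \<in> F. lev k = n} \<le> 2 * sqrt S * q ^ n" .
    qed
    also have "\<dots> \<le> (\<Sum>n. 2 * sqrt S * q ^ n)"
      using q S by (intro sum_le_suminf summable_mult summable_geometric) (auto simp: F_def)
    also have "\<dots> = 2 * sqrt S * (1 / (1 - q))"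
      using q by (subst suminf_mult) (auto simp: suminf_geometric intro: summable_geometric)
    finally show ?thesis .
  qed
  then have "summable f" using f0 by (intro summableI_nonneg_bounded) auto
  then show ?thesis unfolding f_def .
qed

text \<open>
  Borel--Cantelli for the events \<open>B k\<close> that the \<open>k\<close>-th point is too close to an earlier one. The
  threshold is the product of the weights \<open>f j\<close> and \<open>f k\<close>, so the union bound over \<open>j < k\<close> gives a
  probability of order \<open>f k\<close>.
\<close>
lemma AE_eventually_far_apart:
  assumes g: "0 < g"
    and sum: "summable (\<lambda>k. if \<rho> k = 0 then 0 else (1 - (\<rho> k)\<^sup>2) powr (g / 2))"
  shows "AE \<omega> in M. \<exists>k0. \<forall>k\<ge>k0. \<forall>j<k.
    ((1 - (\<rho> j)\<^sup>2) * (1 - (\<rho> k)\<^sup>2)) powr (g / 2) \<le> cmod (1 - cnj (pt k \<omega>) * pt j \<omega>)"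
proof -
  define f where "f k = (if \<rho> k = 0 then 0 else (1 - (\<rho> k)\<^sup>2) powr (g / 2))" for k
  have f0: "0 \<le> f k" for k by (simp add: f_def)
  have "f = (\<lambda>k. if \<rho> k = 0 then 0 else (1 - (\<rho> k)\<^sup>2) powr (g / 2))"
    by (simp add: f_def fun_eq_iff)
  then have sum: "summable f" using sum by simp
  define S where "S = suminf f"
  have S: "0 \<le> S" "sum f {..<k} \<le> S" for k
    unfolding S_def using sum f0 by (auto intro: suminf_nonneg sum_le_suminf)
  let ?e = "\<lambda>j k. ((1 - (\<rho> j)\<^sup>2) * (1 - (\<rho> k)\<^sup>2)) powr (g / 2)"
  have r2: "0 \<le> 1 - (\<rho> k)\<^sup>2" "1 - (\<rho> k)\<^sup>2 \<le> 1" for k using radius[of k] by (simp_all add: power_le_one)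
  let ?E = "\<lambda>j k. {\<omega> \<in> space M. cmod (1 - cnj (pt k \<omega>) * pt j \<omega>) < ?e j k}"
  have [measurable]: "cnj \<in> borel_measurable borel"
    by (intro borel_measurable_continuous_onI continuous_intros)
  have E[measurable]: "?E j k \<in> events" for j k by measurable
  have pE: "prob (?E j k) \<le> 2 * f j * f k" if "j \<noteq> k" for j k
  proof (cases "\<rho> j = 0 \<or> \<rho> k = 0")
    case True
    have "?e j k \<le> 1 powr (g / 2)"
      using g r2[of j] r2[of k] by (intro powr_mono2 mult_le_one) auto
    moreover have "cmod (1 - cnj (pt k \<omega>) * pt j \<omega>) = 1" for \<omega>
      using True by (auto simp: pt_def)
    ultimately have "?E j k = {}" by auto
    then have "prob (?E j k) = 0" by (metis measure_empty)
    then show ?thesis using f0 by simp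
  next
    case False
    have "prob (?E j k) \<le> prob {\<omega> \<in> space M. \<bar>sin (\<theta> j \<omega> - \<theta> k \<omega>)\<bar> < ?e j k}"
    proof (rule finite_measure_mono)
      show "?E j k \<subseteq> {\<omega> \<in> space M. \<bar>sin (\<theta> j \<omega> - \<theta> k \<omega>)\<bar> < ?e j k}"
        unfolding pt_def cnj_rcis_mult_rcis
        using abs_sin_le_norm_one_minus_rcis le_less_trans by blast
    qed measurable
    also have "\<dots> \<le> 2 * ?e j k" using that by (intro prob_abs_sin_less) auto
    also have "2 * ?e j k = 2 * f j * f k" using False r2 by (simp add: f_def powr_mult)
    finally show ?thesis by simp
  qed
  define B where "B k = (\<Union>j<k. ?E j k)" for k
  have B[measurable]: "B k \<in> events" for k unfolding B_def by measurable
  have pB: "prob (B k) \<le> 2 * S * f k" for k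
  proof -
    have "prob (B k) \<le> (\<Sum>j<k. prob (?E j k))"
      unfolding B_def by (rule finite_measure_subadditive_finite) auto
    also have "\<dots> \<le> (\<Sum>j<k. 2 * f k * f j)"
      by (intro sum_mono) (use pE in \<open>auto simp: mult_ac\<close>)
    also have "\<dots> = 2 * f k * sum f {..<k}" by (simp add: sum_distrib_left)
    also have "\<dots> \<le> 2 * f k * S" using S f0 by (intro mult_left_mono) auto
    finally show ?thesis by (simp add: mult_ac)
  qed
  have "AE \<omega> in M. eventually (\<lambda>k. \<omega> \<in> space M - B k) sequentially"
  proof (rule borel_cantelli_AE1)
    show "summable (\<lambda>k. prob (B k))"
      by (rule summable_comparison_test'[where N = 0 and g = "\<lambda>k. 2 * S * f k"])
         (use pB sum in \<open>auto intro: summable_mult\<close>)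
  qed (auto simp: emeasure_eq_measure)
  then show ?thesis
    by (rule AE_mp) (auto intro!: AE_I2 simp: eventually_sequentially B_def not_less)
qed

text \<open>
  Pairs with a point outside the finite set \<open>T\<close> are separated by the kernel estimate. The finitely many
  pairs inside \<open>T\<close> are separated because \<open>\<rho>\<^sub>D\<close> is positive on distinct points.
\<close>
lemma separated_if_eventually_far_apart:
  assumes g: "0 < g" "g < 1"
    and sum: "summable (\<lambda>k. if \<rho> k = 0 then 0 else (1 - (\<rho> k)\<^sup>2) powr (g / 2))"
    and far: "\<And>j k. k0 \<le> k \<Longrightarrow> j < k \<Longrightarrow>
      ((1 - (\<rho> j)\<^sup>2) * (1 - (\<rho> k)\<^sup>2)) powr (g / 2) \<le> cmod (1 - cnj (pt k \<omega>) * pt j \<omega>)"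
  shows "D_separated (random_points \<rho> \<theta> \<omega>)"
proof -
  obtain d B0 where d: "0 < d" and rho: "\<And>z w. cmod z < 1 \<Longrightarrow> cmod w < 1 \<Longrightarrow>
       B0 \<le> max (diag_profile ((cmod z)\<^sup>2)) (diag_profile ((cmod w)\<^sup>2)) \<Longrightarrow>
       ((1 - (cmod z)\<^sup>2) * (1 - (cmod w)\<^sup>2)) powr (g / 2) \<le> cmod (1 - cnj w * z) \<Longrightarrow>
       d \<le> rho_D z w"
    using far_apart_imp_rho_D_ge[OF g] by metis
  define F where "F = {k. 0 < \<rho> k \<and> diag_profile ((\<rho> k)\<^sup>2) < B0}"
  have "finite F"
  proof -
    have "(\<lambda>k. if \<rho> k = 0 then 0 else (1 - (\<rho> k)\<^sup>2) powr (g / 2)) \<longlonglongrightarrow> 0"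
      by (rule summable_LIMSEQ_zero[OF sum])
    then have "\<forall>\<^sub>F k in sequentially. (if \<rho> k = 0 then 0 else (1 - (\<rho> k)\<^sup>2) powr (g / 2)) < exp (- (g / 2) * B0)"
      by (rule order_tendstoD) simp
    then obtain N where N: "\<And>k. N \<le> k \<Longrightarrow> (if \<rho> k = 0 then 0 else (1 - (\<rho> k)\<^sup>2) powr (g / 2)) < exp (- (g / 2) * B0)"
      by (auto simp: eventually_sequentially)
    have "k < N" if "k \<in> F" for k
    proof (rule ccontr)
      assume "\<not> k < N"
      have k: "0 < \<rho> k" "diag_profile ((\<rho> k)\<^sup>2) < B0" using that by (auto simp: F_def)
      have r2: "(\<rho> k)\<^sup>2 < 1" using radius[of k] by (simp add: power_less_one_iff abs_square_less_1)
      have "- ln (1 - (\<rho> k)\<^sup>2) < B0" using diag_profile_ge_log[OF _ r2] k by simp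
      then have "(g / 2) * (- B0) < (g / 2) * ln (1 - (\<rho> k)\<^sup>2)" using g by (intro mult_strict_left_mono) auto
      then have "exp (- (g / 2) * B0) < (1 - (\<rho> k)\<^sup>2) powr (g / 2)"
        using r2 by (simp add: powr_def)
      then show False using N[of k] \<open>\<not> k < N\<close> k by auto
    qed
    then show ?thesis by (intro finite_subset[of F "{..<N}"]) auto
  qed
  define T where "T = insert 0 ((\<lambda>k. pt k \<omega>) ` ({..<k0} \<union> F))"
  have T: "finite T" using \<open>finite F\<close> by (simp add: T_def)
  define V where "V = insert d {rho_D z w |z w. z \<in> T \<and> w \<in> T \<and> z \<noteq> w}"
  have "finite V"
  proof -
    have "{rho_D z w |z w. z \<in> T \<and> w \<in> T \<and> z \<noteq> w} \<subseteq> (\<lambda>(z, w). rho_D z w) ` (T \<times> T)" by auto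
    then show ?thesis using T unfolding V_def by (meson finite.insertI finite_SigmaI finite_imageI finite_subset)
  qed
  have T1: "cmod z < 1" if "z \<in> T" for z using that radius by (auto simp: T_def)
  have "\<forall>v\<in>V. 0 < v" using d T1 rho_D_pos by (auto simp: V_def)
  then have m: "0 < Min V" using \<open>finite V\<close> by (subst Min_gr_iff) (auto simp: V_def)
  obtain n :: nat where n: "inverse (real (Suc n)) < Min V" using reals_Archimedean[OF m] by blast
  have "Min V \<le> rho_D (pt j \<omega>) (pt k \<omega>)" if ne: "pt j \<omega> \<noteq> pt k \<omega>" for j k
  proof (cases "pt j \<omega> \<in> T \<and> pt k \<omega> \<in> T")
    case True
    then have "rho_D (pt j \<omega>) (pt k \<omega>) \<in> V" using ne by (auto simp: V_def)
    then show ?thesis using \<open>finite V\<close> by (rule Min_le[rotated])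
  next
    case False
    have big: "B0 \<le> diag_profile ((\<rho> i)\<^sup>2) \<and> k0 \<le> i" if "pt i \<omega> \<notin> T" for i
    proof -
      have "\<rho> i \<noteq> 0" using that by (auto simp: T_def pt_def)
      then have "0 < \<rho> i" using radius[of i] by simp
      then show ?thesis using that by (auto simp: T_def F_def not_less)
    qed
    have "j \<noteq> k" using ne by auto
    have sym: "cmod (1 - cnj (pt k \<omega>) * pt j \<omega>) = cmod (1 - cnj (pt j \<omega>) * pt k \<omega>)"
      by (metis complex_cnj_cnj complex_cnj_diff complex_cnj_mult complex_cnj_one complex_mod_cnj mult.commute)
    have "((1 - (\<rho> j)\<^sup>2) * (1 - (\<rho> k)\<^sup>2)) powr (g / 2) \<le> cmod (1 - cnj (pt k \<omega>) * pt j \<omega>)"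
    proof (cases "j < k")
      case True
      moreover have "k0 \<le> k" using False big[of j] big[of k] True by auto
      ultimately show ?thesis by (intro far)
    next
      case nless: False
      then have "k < j" using \<open>j \<noteq> k\<close> by simp
      moreover have "k0 \<le> j" using False big[of j] big[of k] \<open>k < j\<close> by auto
      ultimately show ?thesis unfolding sym using far[of j k] by (simp add: mult.commute)
    qed
    moreover have "B0 \<le> max (diag_profile ((\<rho> j)\<^sup>2)) (diag_profile ((\<rho> k)\<^sup>2))"
      using False big[of j] big[of k] by (auto simp: le_max_iff_disj)
    ultimately have "d \<le> rho_D (pt j \<omega>) (pt k \<omega>)" using radius by (intro rho) auto
    moreover have "Min V \<le> d" using \<open>finite V\<close> by (intro Min_le) (auto simp: V_def)
    ultimately show ?thesis by simp
  qed
  moreover have "1 / (real n + 2) \<le> inverse (real (Suc n))" by (simp add: field_simps)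
  ultimately show ?thesis
    unfolding random_points_eq D_separated_range_iff using n by (intro exI[of _ n]) (meson less_imp_le order_trans)
qed

text \<open>
  Almost surely the counts \<open>N\<^sub>n\<close> depend on the radii only. So one outcome that has distinct points and a finite weighted sum
  yields the bound on the number of radii in each annulus.
\<close>
theorem AE_separated:
  assumes \<gamma>: "0 < \<gamma>" "\<gamma> < 1"
    and fin: "AE \<omega> in M. weighted_count_sum \<gamma> (random_points \<rho> \<theta> \<omega>) < \<infinity>"
  shows "AE \<omega> in M. D_separated (random_points \<rho> \<theta> \<omega>)"
proof -
  have "AE \<omega> in M. weighted_count_sum \<gamma> (random_points \<rho> \<theta> \<omega>) < \<infinity>
      \<and> (\<forall>j k. j \<noteq> k \<and> 0 < \<rho> j \<longrightarrow> pt j \<omega> \<noteq> pt k \<omega>)"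
    using fin AE_points_distinct by eventually_elim blast
  from eventually_happens'[OF ae_filter_bot this] obtain \<omega> where
    W: "weighted_count_sum \<gamma> (random_points \<rho> \<theta> \<omega>) < \<infinity>"
    and inj: "\<forall>j k. j \<noteq> k \<and> 0 < \<rho> j \<longrightarrow> pt j \<omega> \<noteq> pt k \<omega>"
    by blast
  define S where "S = enn2real (weighted_count_sum \<gamma> (random_points \<rho> \<theta> \<omega>))"
  have S: "weighted_count_sum \<gamma> (random_points \<rho> \<theta> \<omega>) = ennreal S"
    using W by (simp add: S_def)
  have term_le: "ennreal (2 powr (- \<gamma> * real n)) * (emeasure (count_space UNIV) (level n))\<^sup>2 \<le> ennreal S" for n
  proof -
    have "ennreal (2 powr (- \<gamma> * real n)) * (emeasure (count_space UNIV) (level n))\<^sup>2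
        \<le> ennreal (2 powr (- \<gamma> * real n)) * (annulus_count (random_points \<rho> \<theta> \<omega>) n)\<^sup>2"
      using card_level_le_annulus_count[OF inj] by (intro mult_left_mono power_mono) auto
    also have "\<dots> \<le> weighted_count_sum \<gamma> (random_points \<rho> \<theta> \<omega>)"
      unfolding weighted_count_sum_def
      using sum_le_suminf[of "\<lambda>n. ennreal (2 powr (- \<gamma> * real n)) * (annulus_count (random_points \<rho> \<theta> \<omega>) n)\<^sup>2" "{n}"]
      by simp
    finally show ?thesis by (simp add: S)
  qed
  have level: "finite (level n)" for n
  proof (rule ccontr)
    assume "infinite (level n)"
    then show False using term_le[of n] by (simp add: ennreal_mult_top power2_eq_square top_unique)
  qed
  have card: "(real (card (level n)))\<^sup>2 \<le> S * 2 powr (\<gamma> * real n)" for n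
  proof -
    have "ennreal (2 powr (- \<gamma> * real n) * (real (card (level n)))\<^sup>2) \<le> ennreal S"
      using term_le[of n] level[of n]
      by (simp add: ennreal_of_nat_eq_real_of_nat ennreal_mult ennreal_power)
    then have "2 powr (- \<gamma> * real n) * (real (card (level n)))\<^sup>2 \<le> S"
      by (subst (asm) ennreal_le_iff) (auto simp: S_def)
    then have "2 powr (\<gamma> * real n) * (2 powr (- \<gamma> * real n) * (real (card (level n)))\<^sup>2) \<le> 2 powr (\<gamma> * real n) * S"
      by (intro mult_left_mono) auto
    also have "2 powr (\<gamma> * real n) * (2 powr (- \<gamma> * real n) * (real (card (level n)))\<^sup>2) = (real (card (level n)))\<^sup>2"
      by (simp add: powr_minus field_simps)
    finally show ?thesis by (simp add: mult.commute)
  qed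
  \<comment> \<open>any exponent strictly between \<open>\<gamma>\<close> and \<open>1\<close> works\<close>
  define g where "g = (1 + \<gamma>) / 2"
  have g: "0 < g" "g < 1" "\<gamma> < g" "g \<le> 2" using \<gamma> by (auto simp: g_def)
  note summable = summable_radius_weights[OF level card g(1,3,4)]
  from AE_eventually_far_apart[OF g(1) summable] show ?thesis
  proof (rule AE_mp, intro AE_I2 impI)
    fix \<omega>
    assume "\<exists>k0. \<forall>k\<ge>k0. \<forall>j<k.
      ((1 - (\<rho> j)\<^sup>2) * (1 - (\<rho> k)\<^sup>2)) powr (g / 2) \<le> cmod (1 - cnj (pt k \<omega>) * pt j \<omega>)"
    then obtain k0 where "\<forall>k\<ge>k0. \<forall>j<k.
      ((1 - (\<rho> j)\<^sup>2) * (1 - (\<rho> k)\<^sup>2)) powr (g / 2) \<le> cmod (1 - cnj (pt k \<omega>) * pt j \<omega>)" ..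
    then show "D_separated (random_points \<rho> \<theta> \<omega>)"
      by (intro separated_if_eventually_far_apart[OF g(1,2) summable]) auto
  qed
qed

end

section \<open>The kernel at pairs of points that are close\<close>

lemma isCont_kernel_profile:
  assumes "cmod x < 1"
  shows "isCont kernel_profile x"
proof -
  define r where "r = (1 + cmod x) / 2"
  have r: "cmod x < r" "r < 1" "0 \<le> r" using assms by (auto simp: r_def)
  have "isCont (\<lambda>x. \<Sum>n. (1 / of_nat (Suc n)) * x ^ n) x"
  proof (rule isCont_powser)
    show "summable (\<lambda>n. (1 / of_nat (Suc n)) * complex_of_real r ^ n)"
      using kernel_profile_sums[of "of_real r"] r by (simp add: sums_iff del: of_nat_Suc)
    show "cmod x < cmod (of_real r)" using r by simp
  qed
  moreover have ev: "\<forall>\<^sub>F y in nhds x. (\<Sum>n. (1 / of_nat (Suc n)) * y ^ n) = kernel_profile y"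
  proof -
    have "\<forall>\<^sub>F y in nhds x. y \<in> ball 0 1"
      using assms by (intro eventually_nhds_in_open) auto
    then show ?thesis
      by eventually_elim (use kernel_profile_sums in \<open>auto simp: sums_iff simp del: of_nat_Suc\<close>)
  qed
  ultimately show ?thesis using isCont_cong[OF ev] by simp
qed

text \<open>
  The points accumulate at some \<open>p\<close> in the open disk, and \<open>\<rho>\<^sub>D\<close> is continuous at \<open>(p, p)\<close> with value \<open>0\<close>.
\<close>
lemma ex_close_pair_small_rho_D:
  assumes inf: "infinite L" and R: "\<And>z. z \<in> L \<Longrightarrow> cmod z \<le> R" "R < 1" and d: "0 < d"
  shows "\<exists>z\<in>L. \<exists>w\<in>L. z \<noteq> w \<and> rho_D z w < d"
proof -
  have "compact (cball (0::complex) R)" by simp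
  moreover have "L \<subseteq> cball 0 R" using R by auto
  ultimately obtain p where p: "p \<in> cball 0 R" "p islimpt L"
    using inf by (meson Heine_Borel_imp_Bolzano_Weierstrass)
  have p1: "cmod p < 1" using p R by simp
  define F where "F q = 1 - (cmod (kernel_profile (cnj (snd q) * fst q)))\<^sup>2
    / (cmod (kernel_profile (cnj (fst q) * fst q)) * cmod (kernel_profile (cnj (snd q) * snd q)))" for q :: "complex \<times> complex"
  have diag: "cmod (kernel_profile (cnj z * z)) = diag_profile ((cmod z)\<^sup>2)" if z: "cmod z < 1" for z
  proof -
    have "(cmod z)\<^sup>2 < 1" using z by (simp add: power_less_one_iff abs_square_less_1)
    moreover have "cnj z * z = of_real ((cmod z)\<^sup>2)" by (metis complex_norm_square mult.commute)
    ultimately show ?thesis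
      using diag_profile_norm_ge_1[OF z] by (simp add: kernel_profile_of_real del: of_real_power)
  qed
  have cont: "((\<lambda>q. kernel_profile (h q)) \<longlongrightarrow> kernel_profile (cnj p * p)) (nhds (p, p))"
    if "(h \<longlongrightarrow> cnj p * p) (nhds (p, p))" for h
    by (rule isCont_tendsto_compose[OF isCont_kernel_profile that])
       (rule norm_mult_cnj_less_1[OF p1 p1])
  have fs: "(fst \<longlongrightarrow> p) (nhds (p, p))" "(snd \<longlongrightarrow> p) (nhds (p, p))"
    by (auto intro!: tendsto_eq_intros filterlim_ident)
  have Kp: "1 \<le> cmod (kernel_profile (cnj p * p))"
    using diag[OF p1] diag_profile_norm_ge_1[OF p1] by simp
  have "(F \<longlongrightarrow> 1 - (cmod (kernel_profile (cnj p * p)))\<^sup>2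
      / (cmod (kernel_profile (cnj p * p)) * cmod (kernel_profile (cnj p * p)))) (nhds (p, p))"
    unfolding F_def using Kp by (intro tendsto_intros cont fs) auto
  also have "1 - (cmod (kernel_profile (cnj p * p)))\<^sup>2
      / (cmod (kernel_profile (cnj p * p)) * cmod (kernel_profile (cnj p * p))) = 0"
    using Kp by (auto simp: power2_eq_square)
  finally have "\<forall>\<^sub>F q in nhds (p, p). F q < d\<^sup>2"
    using d by (intro order_tendstoD(2)[where y = "0::real"]) auto
  then obtain e where e: "0 < e" "\<And>q. dist q (p, p) < e \<Longrightarrow> F q < d\<^sup>2"
    by (auto simp: eventually_nhds_metric)
  have "infinite (L \<inter> ball p (e / 2))" using p(2) e(1) by (simp add: islimpt_eq_infinite_ball)
  then obtain z w where zw: "z \<in> L \<inter> ball p (e / 2)" "w \<in> L \<inter> ball p (e / 2)" "z \<noteq> w"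
    by (metis finite.emptyI finite_insert finite_subset insertCI subsetI)
  have "dist (z, w) (p, p) \<le> dist z p + dist w p"
    unfolding dist_prod_def using sqrt_sum_squares_le_sum_abs[of "dist z p" "dist w p"] by simp
  also have "\<dots> < e" using zw by (simp add: dist_commute)
  finally have Fd: "F (z, w) < d\<^sup>2" by (rule e(2))
  have z1: "cmod z < 1" and w1: "cmod w < 1" using zw R by fastforce+
  have "rho_D z w = sqrt (F (z, w))"
    unfolding rho_D_eq[OF z1 w1] F_def by (simp add: diag[OF z1] diag[OF w1])
  also have "\<dots> < sqrt (d\<^sup>2)" using Fd by (rule real_sqrt_less_mono)
  finally have "rho_D z w < d" using d by simp
  then show ?thesis using zw by blast
qed

text \<open>
  The radial gap \<open>1 - r s\<close> is at most of order \<open>(1/2)\<^sup>n\<close>, and because of \<open>\<gamma> \<le> 1\<close> it is dominated by the angular gap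
  \<open>\<bar>a - b\<bar>\<close> that is allowed here.
\<close>
lemma one_minus_norm_le_powr:
  assumes n: "1 - (1/2) ^ n \<le> r" "1 - (1/2) ^ n \<le> s" "r < 1" "s < 1" "0 \<le> r" "0 \<le> s" and \<gamma>: "\<gamma> \<le> 1"
    and ab: "\<bar>a - b\<bar> \<le> 2 * pi * 2 powr (- \<gamma> * real n)"
  shows "cmod (1 - cnj (rcis s b) * rcis r a) \<le> 10 * 2 powr (- \<gamma> * real n)"
proof -
  let ?t = "a - b"
  have decomp: "1 - cnj (rcis s b) * rcis r a = of_real (1 - r * s) + of_real (r * s) * (1 - cis ?t)"
    unfolding cnj_rcis_mult_rcis unfolding rcis_def by (simp add: right_diff_distrib)
  have "cmod (1 - cnj (rcis s b) * rcis r a)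
      \<le> cmod (of_real (1 - r * s)) + cmod (of_real (r * s) * (1 - cis ?t))"
    unfolding decomp by (rule norm_triangle_ineq)
  also have "cmod (of_real (1 - r * s)) = 1 - r * s"
    using assms mult_le_one[of r s] by (simp only: norm_of_real) simp
  also have "1 - r * s \<le> (1 - r) + (1 - s)"
  proof -
    have "0 \<le> (1 - r) * (1 - s)" using assms by simp
    then show ?thesis by (simp add: algebra_simps)
  qed
  also have "cmod (of_real (r * s) * (1 - cis ?t)) \<le> 1 * cmod (1 - cis ?t)"
    unfolding norm_mult using assms mult_le_one[of r s] by (intro mult_right_mono) (auto simp: norm_mult)
  also have "cmod (1 - cis ?t) \<le> \<bar>?t\<bar>"
    using iexp_approx1[of ?t 0] by (simp add: cis_conv_exp norm_minus_commute)
  finally have "cmod (1 - cnj (rcis s b) * rcis r a) \<le> 2 * (1/2) ^ n + \<bar>a - b\<bar>"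
    using n by simp
  moreover have "(1/2 :: real) ^ n \<le> 2 powr (- \<gamma> * real n)"
  proof -
    have "(1/2 :: real) ^ n = 2 powr (- real n)"
      by (simp add: powr_minus powr_realpow power_one_over inverse_eq_divide)
    also have "\<dots> \<le> 2 powr (- \<gamma> * real n)" using \<gamma> mult_right_mono[OF \<gamma>, of "real n"] by (intro powr_mono) auto
    finally show ?thesis .
  qed
  moreover have "2 * pi * 2 powr (- \<gamma> * real n) \<le> 8 * 2 powr (- \<gamma> * real n)"
    using pi_less_4 by (intro mult_right_mono) auto
  ultimately show ?thesis using ab by linarith
qed

text \<open>
  For large \<open>n\<close>, the kernel is at least about \<open>\<gamma> n ln 2\<close>, whereas both diagonal values are at most \<open>1 + (n + 1) ln 2\<close>;
  so the quotient of the two is at least any given \<open>\<eta>\<close> below \<open>\<gamma>\<close>.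
\<close>
lemma close_imp_rho_D_le:
  assumes \<gamma>: "0 \<le> \<eta>" "\<eta> < \<gamma>" "\<gamma> \<le> 1"
  obtains n0 where "\<And>n z w. n0 \<le> n \<Longrightarrow> cmod z < 1 - (1/2) ^ (n + 1) \<Longrightarrow> cmod w < 1 - (1/2) ^ (n + 1) \<Longrightarrow>
    cmod (1 - cnj w * z) \<le> 10 * 2 powr (- \<gamma> * real n) \<Longrightarrow> rho_D z w \<le> sqrt (1 - \<eta>\<^sup>2)"
proof -
  obtain n0 :: nat where n0: "(ln 10 + \<eta> * (1 + ln 2)) / ((\<gamma> - \<eta>) * ln 2) < real n0"
    using reals_Archimedean2 by blast
  show thesis
  proof (rule that[of n0])
    fix n and z w :: complex
    assume n: "n0 \<le> n" and zn: "cmod z < 1 - (1/2) ^ (n + 1)" and wn: "cmod w < 1 - (1/2) ^ (n + 1)"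
      and close: "cmod (1 - cnj w * z) \<le> 10 * 2 powr (- \<gamma> * real n)"
    have z: "cmod z < 1" and w: "cmod w < 1" using zn wn zero_less_power[of "1/2::real" "n + 1"] by linarith+
    define D where "D = 1 + (real n + 1) * ln 2"
    have D: "0 < D" by (simp add: D_def add_pos_nonneg)
    have diag: "diag_profile ((cmod x)\<^sup>2) \<le> D" if xn: "cmod x < 1 - (1/2) ^ (n + 1)" and x: "cmod x < 1" for x
    proof -
      have x2: "(cmod x)\<^sup>2 \<le> cmod x" using x by (simp add: power2_eq_square mult_left_le)
      have p: "(1/2::real) ^ (n + 1) < 1 - (cmod x)\<^sup>2" using x2 xn by simp
      have "ln ((1/2::real) ^ (n + 1)) \<le> ln (1 - (cmod x)\<^sup>2)" using p by (intro ln_mono) auto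
      moreover have "ln ((1/2::real) ^ (n + 1)) = - ((real n + 1) * ln 2)"
        by (subst ln_realpow) (auto simp: ln_div)
      ultimately have "- ln (1 - (cmod x)\<^sup>2) \<le> (real n + 1) * ln 2" by simp
      then show ?thesis
        using diag_profile_le_log[of "(cmod x)\<^sup>2"] x2 x by (simp add: D_def)
    qed
    define u where "u = 1 - cnj w * z"
    have x: "cmod (cnj w * z) < 1" by (rule norm_mult_cnj_less_1[OF z w])
    have u0: "u \<noteq> 0" using x by (auto simp: u_def)
    have "ln (cmod u) \<le> ln (10 * 2 powr (- \<gamma> * real n))"
      using close u0 by (intro ln_mono) (auto simp: u_def)
    also have "\<dots> = ln 10 - \<gamma> * real n * ln 2" by (simp add: ln_mult ln_powr)
    finally have "\<gamma> * real n * ln 2 - ln 10 \<le> - ln (cmod u)" by simp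
    also have "\<dots> \<le> \<bar>Re (Ln u)\<bar>" using Re_Ln[OF u0] by simp
    also have "\<dots> \<le> cmod (Ln u)" by (rule abs_Re_le_cmod)
    also have "\<dots> = cmod (cnj w * z) * cmod (kernel_profile (cnj w * z))"
      unfolding norm_kernel_profile_mult u_def using Ln_inverse_one_minus[OF x] by simp
    also have "\<dots> \<le> 1 * cmod (kernel_profile (cnj w * z))"
      using x by (intro mult_right_mono) auto
    finally have K: "\<gamma> * real n * ln 2 - ln 10 \<le> cmod (kernel_profile (cnj w * z))" by simp
    have "(ln 10 + \<eta> * (1 + ln 2)) / ((\<gamma> - \<eta>) * ln 2) < real n" using n0 n by simp
    then have "ln 10 + \<eta> * (1 + ln 2) < real n * ((\<gamma> - \<eta>) * ln 2)"
      using \<gamma> by (subst (asm) pos_divide_less_eq) auto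
    then have "\<eta> * D \<le> \<gamma> * real n * ln 2 - ln 10" by (simp add: D_def algebra_simps)
    then have "\<eta> * D \<le> cmod (kernel_profile (cnj w * z))" using K by simp
    then have K2: "(\<eta> * D)\<^sup>2 \<le> (cmod (kernel_profile (cnj w * z)))\<^sup>2"
      using \<gamma> D by (intro power_mono) auto
    let ?A = "diag_profile ((cmod z)\<^sup>2)" and ?B = "diag_profile ((cmod w)\<^sup>2)"
    have AB: "0 < ?A * ?B"
      using diag_profile_norm_ge_1[OF z] diag_profile_norm_ge_1[OF w] by simp
    have "?A * ?B \<le> D * D"
      using diag[OF zn z] diag[OF wn w] D diag_profile_norm_ge_1[OF w] by (intro mult_mono) auto
    then have "\<eta>\<^sup>2 * (?A * ?B) \<le> \<eta>\<^sup>2 * (D * D)" by (intro mult_left_mono) auto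
    also have "\<dots> \<le> (cmod (kernel_profile (cnj w * z)))\<^sup>2"
      using K2 by (simp add: power2_eq_square mult_ac)
    finally have "\<eta>\<^sup>2 \<le> (cmod (kernel_profile (cnj w * z)))\<^sup>2 / (?A * ?B)"
      using AB by (simp add: pos_le_divide_eq)
    then show "rho_D z w \<le> sqrt (1 - \<eta>\<^sup>2)"
      unfolding rho_D_eq[OF z w] by (intro real_sqrt_le_mono) simp
  qed
qed

lemma card_increasing_pairs:
  fixes D :: "nat set"
  assumes "finite D"
  shows "2 * card {(i, j). i \<in> D \<and> j \<in> D \<and> i < j} + card D = (card D)\<^sup>2"
proof -
  let ?P = "{(i, j). i \<in> D \<and> j \<in> D \<and> i < j}" and ?Q = "{(i, j). i \<in> D \<and> j \<in> D \<and> j < i}"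
    and ?R = "(\<lambda>i. (i, i)) ` D"
  have fin: "finite ?P" "finite ?Q" "finite ?R"
    using assms by (auto intro: finite_subset[of _ "D \<times> D"])
  have "D \<times> D = (?P \<union> ?Q) \<union> ?R" by auto
  then have "card (D \<times> D) = card ((?P \<union> ?Q) \<union> ?R)" by simp
  also have "\<dots> = card (?P \<union> ?Q) + card ?R" using fin by (intro card_Un_disjoint) auto
  also have "card (?P \<union> ?Q) = card ?P + card ?Q" using fin by (intro card_Un_disjoint) auto
  also have "card ?Q = card ?P" by (rule bij_betw_same_card[of prod.swap]) (auto simp: bij_betw_def inj_on_def image_iff)
  also have "card ?R = card D" by (rule card_image) (auto simp: inj_on_def)
  finally show ?thesis by (simp add: power2_eq_square card_cartesian_product)
qed

section \<open>Almost sure failure of separation\<close>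

context random_angles
begin

definition same_box :: "nat \<Rightarrow> nat \<Rightarrow> nat \<Rightarrow> 'a set" where
  "same_box m i j = {\<omega> \<in> space M. box_index m (\<theta> i \<omega>) = box_index m (\<theta> j \<omega>)}"

lemma same_box_event[measurable]: "same_box m i j \<in> events"
  unfolding same_box_def by measurable

lemma same_box_commute: "same_box m i j = same_box m j i"
  by (auto simp: same_box_def)

lemma prob_same_box_fresh:
  assumes m': "0 < m'" and v: "v \<notin> {i, j, u}"
  shows "prob (same_box m i j \<inter> same_box m' u v) = 1 / real m' * prob (same_box m i j)"
proof -
  let ?B = "\<lambda>m. {p :: real \<times> real. box_index m (fst p) = box_index m (snd p)}"
  have B: "?B m \<in> sets (borel \<Otimes>\<^sub>M borel)" for m
  proof -
    have "{p \<in> space (borel \<Otimes>\<^sub>M borel :: (real \<times> real) measure). box_index m (fst p) = box_index m (snd p)}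
        \<in> sets (borel \<Otimes>\<^sub>M borel)" by measurable
    then show ?thesis by (simp add: space_pair_measure)
  qed
  have "AE x in distr M borel (\<theta> u). emeasure (distr M borel (\<theta> v)) (Pair x -` ?B m') = ennreal (1 / real m')"
    using AE_emeasure_same_box[OF m'] by (simp only: angle_distr vimage_def mem_Collect_eq fst_conv snd_conv)
  note * = prob_fresh_coordinate_eq[OF indep v B[of m] B[of m'] this]
  have "same_box m i j \<inter> same_box m' u v
      = {\<omega> \<in> space M. (\<theta> i \<omega>, \<theta> j \<omega>) \<in> ?B m \<and> (\<theta> u \<omega>, \<theta> v \<omega>) \<in> ?B m'}"
    and "same_box m i j = {\<omega> \<in> space M. (\<theta> i \<omega>, \<theta> j \<omega>) \<in> ?B m}"
    by (auto simp: same_box_def)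
  then have "emeasure M (same_box m i j \<inter> same_box m' u v) = ennreal (1 / real m') * emeasure M (same_box m i j)"
    using * by simp
  then show ?thesis by (simp add: emeasure_eq_measure ennreal_mult[symmetric])
qed

lemma prob_same_box:
  assumes "0 < m" "u \<noteq> v"
  shows "prob (same_box m u v) = 1 / real m"
proof -
  have "same_box m u u = space M" by (auto simp: same_box_def)
  moreover have "same_box m u v \<subseteq> space M" by (auto simp: same_box_def)
  ultimately show ?thesis
    using prob_same_box_fresh[OF assms(1), of v u u u m] assms(2) by (simp add: Int_absorb1 prob_space)
qed

text \<open>
  Distinct pairs cannot have both indices in common, so one of the pairs has an index that is fresh for the other.
\<close>
lemma prob_same_box_Int:
  assumes "0 < m" "0 < m'" "i < j" "i' < j'" "(i, j) \<noteq> (i', j')"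
  shows "prob (same_box m i j \<inter> same_box m' i' j') = prob (same_box m i j) * prob (same_box m' i' j')"
proof (cases "j' \<in> {i, j}")
  case False
  then show ?thesis
    using prob_same_box_fresh[OF assms(2), of j' i j i' m] prob_same_box[OF assms(2), of i' j'] assms by auto
next
  case True
  \<comment> \<open>\<open>j'\<close> is shared, hence \<open>i'\<close> is fresh: \<open>i' < i < j\<close> if \<open>j' = i\<close>, and \<open>i' \<noteq> i\<close>, \<open>i' < j\<close> if \<open>j' = j\<close>\<close>
  then have "i' \<notin> {i, j, j'}" using assms by auto
  then show ?thesis
    using prob_same_box_fresh[OF assms(2), of i' i j j' m] prob_same_box[OF assms(2), of j' i'] assms
    by (simp add: same_box_commute[of m' j' i'])
qed

text \<open>
  A pair of indices determines its annulus, so events belonging to different annuli come from different pairs, and all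
  of them are pairwise independent. Discarding the annuli below \<open>n0\<close> does not affect divergence.
\<close>
lemma AE_same_box_pair:
  assumes fin: "\<And>n. finite (level n)" and m: "\<And>n. 0 < m n"
    and div: "\<not> summable (\<lambda>n. ((real (card (level n)))\<^sup>2 - real (card (level n))) / real (m n))"
  shows "AE \<omega> in M. \<exists>n\<ge>n0. \<exists>i j. i \<in> level n \<and> j \<in> level n \<and> i < j \<and> \<omega> \<in> same_box (m n) i j"
proof -
  define P where "P n = {(i, j). i \<in> level n \<and> j \<in> level n \<and> i < j}" for n
  define I where "I = {(n, i, j). n0 \<le> n \<and> (i, j) \<in> P n}"
  define A where "A = (\<lambda>(n, i, j). same_box (m n) i j)"
  have finP: "finite (P n)" for n
    using fin[of n] by (intro finite_subset[of "P n" "level n \<times> level n"]) (auto simp: P_def)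
  have cardP: "2 * real (card (P n)) = (real (card (level n)))\<^sup>2 - real (card (level n))" for n
  proof -
    have "real (2 * card (P n) + card (level n)) = real ((card (level n))\<^sup>2)"
      using card_increasing_pairs[OF fin] unfolding P_def by presburger
    then show ?thesis by simp
  qed
  have ndiv: "\<not> summable (\<lambda>n. real (card (P (n + n0))) / real (m (n + n0)))"
  proof
    assume "summable (\<lambda>n. real (card (P (n + n0))) / real (m (n + n0)))"
    then have "summable (\<lambda>n. real (card (P n)) / real (m n))"
      by (subst (asm) summable_iff_shift[where f = "\<lambda>n. real (card (P n)) / real (m n)"])
    then have "summable (\<lambda>n. 2 * (real (card (P n)) / real (m n)))" by (rule summable_mult)
    then show False using div by (simp add: cardP)
  qed
  have "AE \<omega> in M. \<exists>x\<in>I. \<omega> \<in> A x"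
  proof (rule AE_pairwise_indep_event_occurs)
    show "A x \<in> events" if "x \<in> I" for x by (cases x) (simp add: A_def)
    show "prob (A x \<inter> A y) = prob (A x) * prob (A y)" if xy: "x \<in> I" "y \<in> I" "x \<noteq> y" for x y
    proof -
      obtain n i j n' i' j' where x: "x = (n, i, j)" and y: "y = (n', i', j')" by (metis prod_cases3)
      have "(i, j) \<noteq> (i', j')"
        using xy level_unique[of i n n'] unfolding x y by (auto simp: I_def P_def)
      then show ?thesis using xy unfolding x y by (auto simp: I_def P_def A_def intro!: prob_same_box_Int m)
    qed
    fix C :: real
    have "\<exists>N. C \<le> (\<Sum>n<N. real (card (P (n + n0))) / real (m (n + n0)))"
    proof (rule ccontr)
      assume "\<not> ?thesis"
      then have "(\<Sum>n<N. real (card (P (n + n0))) / real (m (n + n0))) \<le> C" for N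
        by (meson linear)
      then have "summable (\<lambda>n. real (card (P (n + n0))) / real (m (n + n0)))"
        by (intro summableI_nonneg_bounded) auto
      then show False using ndiv by simp
    qed
    then obtain N where N: "C \<le> (\<Sum>n<N. real (card (P (n + n0))) / real (m (n + n0)))" by blast
    define F where "F = (SIGMA n:(\<lambda>n. n + n0) ` {..<N}. P n)"
    have "(\<Sum>x\<in>F. prob (A x)) = (\<Sum>n\<in>(\<lambda>n. n + n0) ` {..<N}. \<Sum>p\<in>P n. prob (A (n, p)))"
      unfolding F_def using finP by (subst sum.Sigma) auto
    also have "\<dots> = (\<Sum>n<N. \<Sum>p\<in>P (n + n0). prob (A (n + n0, p)))"
      by (subst sum.reindex) (auto simp: inj_on_def)
    also have "\<dots> = (\<Sum>n<N. \<Sum>p\<in>P (n + n0). 1 / real (m (n + n0)))"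
    proof (intro sum.cong refl)
      fix n p assume "p \<in> P (n + n0)"
      then show "prob (A (n + n0, p)) = 1 / real (m (n + n0))"
        using prob_same_box[OF m[of "n + n0"]] by (auto simp: A_def P_def)
    qed
    also have "\<dots> = (\<Sum>n<N. real (card (P (n + n0))) / real (m (n + n0)))" by simp
    finally have "C \<le> (\<Sum>x\<in>F. prob (A x))" using N by simp
    moreover have "F \<subseteq> I" by (auto simp: F_def I_def)
    moreover have "finite F" using finP by (auto simp: F_def)
    ultimately show "\<exists>F\<subseteq>I. finite F \<and> C \<le> (\<Sum>x\<in>F. prob (A x))" by blast
  qed simp
  then show ?thesis
    by (rule AE_mp) (intro AE_I2 impI, auto simp: I_def P_def A_def)
qed

text \<open>
  The number of ordered pairs \<open>c (c - 1)\<close> may replace \<open>(c + 1)\<^sup>2\<close>, since \<open>(c + 1)\<^sup>2 \<le> 4 + 4 c (c - 1)\<close> and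
  the constant \<open>4\<close> contributes a geometric series.
\<close>
lemma weighted_count_sum_finite:
  assumes fin: "\<And>n. finite (level n)" and \<gamma>: "0 < \<gamma>"
    and sum: "summable (\<lambda>n. 2 powr (- \<gamma> * real n) * ((real (card (level n)))\<^sup>2 - real (card (level n))))"
  shows "weighted_count_sum \<gamma> (random_points \<rho> \<theta> \<omega>) < \<infinity>"
proof -
  let ?c = "\<lambda>n. real (card (level n))"
  let ?b = "\<lambda>n. 4 * (2 powr (- \<gamma>)) ^ n + 4 * (2 powr (- \<gamma> * real n) * ((?c n)\<^sup>2 - ?c n))"
  have pw: "(2 powr (- \<gamma>)) ^ n = 2 powr (- \<gamma> * real n)" for n
    using powr_realpow[of "2 powr (- \<gamma>)" n] by (simp add: powr_powr)
  have le: "2 powr (- \<gamma> * real n) * (?c n + 1)\<^sup>2 \<le> ?b n" for n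
  proof -
    have "(?c n + 1)\<^sup>2 \<le> 4 + 4 * ((?c n)\<^sup>2 - ?c n)"
      using zero_le_power2[of "?c n - 1"] by (simp add: power2_eq_square algebra_simps)
    then have "2 powr (- \<gamma> * real n) * (?c n + 1)\<^sup>2 \<le> 2 powr (- \<gamma> * real n) * (4 + 4 * ((?c n)\<^sup>2 - ?c n))"
      by (intro mult_left_mono) auto
    then show ?thesis unfolding pw by (simp add: algebra_simps)
  qed
  have "summable ?b"
    using sum \<gamma> powr_less_cancel_iff[of 2 "- \<gamma>" 0]
    by (intro summable_add summable_mult summable_geometric) auto
  then have s: "summable (\<lambda>n. 2 powr (- \<gamma> * real n) * (?c n + 1)\<^sup>2)"
    by (rule summable_comparison_test'[where N = 0]) (use le in auto)
  have "weighted_count_sum \<gamma> (random_points \<rho> \<theta> \<omega>) \<le> (\<Sum>n. ennreal (2 powr (- \<gamma> * real n) * (?c n + 1)\<^sup>2))"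
    unfolding weighted_count_sum_def
  proof (intro suminf_le summableI)
    fix n
    have "ennreal (2 powr (- \<gamma> * real n)) * (annulus_count (random_points \<rho> \<theta> \<omega>) n)\<^sup>2
        \<le> ennreal (2 powr (- \<gamma> * real n)) * (ennreal (?c n + 1))\<^sup>2"
      using annulus_count_le_card_level[OF fin] by (intro mult_left_mono power_mono) auto
    also have "\<dots> = ennreal (2 powr (- \<gamma> * real n) * (?c n + 1)\<^sup>2)"
      by (simp add: ennreal_power ennreal_mult del: ennreal_plus)
    finally show "ennreal (2 powr (- \<gamma> * real n)) * (annulus_count (random_points \<rho> \<theta> \<omega>) n)\<^sup>2
        \<le> ennreal (2 powr (- \<gamma> * real n) * (?c n + 1)\<^sup>2)" .
  qed
  also have "\<dots> = ennreal (\<Sum>n. 2 powr (- \<gamma> * real n) * (?c n + 1)\<^sup>2)"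
    by (rule suminf_ennreal_eq[OF _ summable_sums[OF s]]) auto
  also have "\<dots> < \<infinity>" by simp
  finally show ?thesis .
qed

text \<open>
  An annulus with infinitely many points contains arbitrarily close ones. If there is no such annulus, the arcs
  into which the \<open>n\<close>-th annulus is cut have length about \<open>2 powr (- \<gamma> n)\<close>, with \<open>\<gamma> < 1\<close> chosen according to \<open>d\<close>,
  and two points in a common arc of an annulus far out are the desired pair.
\<close>
lemma AE_ex_close_pair:
  assumes inf: "\<And>\<gamma>. \<gamma> \<in> {1/2<..<1} \<Longrightarrow> AE \<omega> in M. weighted_count_sum \<gamma> (random_points \<rho> \<theta> \<omega>) = \<infinity>"
    and d: "0 < d" "d < 1"
  shows "AE \<omega> in M. \<exists>j k. pt j \<omega> \<noteq> pt k \<omega> \<and> rho_D (pt j \<omega>) (pt k \<omega>) \<le> d"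
proof (cases "\<forall>n. finite (level n)")
  case False
  then obtain n where n: "infinite (level n)" by blast
  from AE_points_distinct show ?thesis
  proof (rule AE_mp, intro AE_I2 impI)
    fix \<omega> assume dist: "\<forall>j k. j \<noteq> k \<and> 0 < \<rho> j \<longrightarrow> pt j \<omega> \<noteq> pt k \<omega>"
    have "inj_on (\<lambda>k. pt k \<omega>) (level n)" using dist by (auto simp: inj_on_def level_def)
    then have "infinite ((\<lambda>k. pt k \<omega>) ` level n)" using n finite_imageD by blast
    then have "\<exists>z\<in>(\<lambda>k. pt k \<omega>) ` level n. \<exists>w\<in>(\<lambda>k. pt k \<omega>) ` level n. z \<noteq> w \<and> rho_D z w < d"
      by (rule ex_close_pair_small_rho_D[where R = "1 - (1/2) ^ (n + 1)"]) (auto simp: level_def d)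
    then show "\<exists>j k. pt j \<omega> \<noteq> pt k \<omega> \<and> rho_D (pt j \<omega>) (pt k \<omega>) \<le> d" by (auto intro: less_imp_le)
  qed
next
  case True
  then have fin: "finite (level n)" for n by blast
  define \<eta> where "\<eta> = sqrt (1 - d\<^sup>2)"
  have d2: "0 < d\<^sup>2" "d\<^sup>2 < 1" using d by (simp_all add: power_less_one_iff)
  have \<eta>: "0 \<le> \<eta>" "\<eta> < 1" "sqrt (1 - \<eta>\<^sup>2) = d" using d2 d by (simp_all add: \<eta>_def)
  \<comment> \<open>\<open>\<eta>\<close> is the ratio needed for \<open>rho_D \<le> d\<close>, and \<open>\<gamma>\<close> is an admissible exponent above it\<close>
  define \<gamma> where "\<gamma> = max (3/4) ((1 + \<eta>) / 2)"
  have \<gamma>: "\<gamma> \<in> {1/2<..<1}" "\<eta> < \<gamma>" "\<gamma> \<le> 1" "0 < \<gamma>" using \<eta> by (auto simp: \<gamma>_def max_def)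
  obtain n0 where n0: "\<And>n z w. n0 \<le> n \<Longrightarrow> cmod z < 1 - (1/2) ^ (n + 1) \<Longrightarrow> cmod w < 1 - (1/2) ^ (n + 1) \<Longrightarrow>
    cmod (1 - cnj w * z) \<le> 10 * 2 powr (- \<gamma> * real n) \<Longrightarrow> rho_D z w \<le> d"
    using close_imp_rho_D_le[OF \<eta>(1) \<gamma>(2,3)] unfolding \<eta>(3) by metis
  define m where "m n = nat \<lceil>2 powr (\<gamma> * real n)\<rceil>" for n
  have m: "2 powr (\<gamma> * real n) \<le> real (m n)" "real (m n) \<le> 2 * 2 powr (\<gamma> * real n)" for n
  proof -
    show "2 powr (\<gamma> * real n) \<le> real (m n)" unfolding m_def by (rule real_nat_ceiling_ge)
    have "1 \<le> 2 powr (\<gamma> * real n)" using \<gamma> by (intro ge_one_powr_ge_zero) auto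
    moreover have "real (m n) \<le> 2 powr (\<gamma> * real n) + 1"
      unfolding m_def by (simp add: of_nat_nat)
    ultimately show "real (m n) \<le> 2 * 2 powr (\<gamma> * real n)" by simp
  qed
  have m0: "0 < m n" for n
  proof -
    have "0 < 2 powr (\<gamma> * real n)" by simp
    then have "0 < real (m n)" using m(1) by (rule less_le_trans)
    then show ?thesis by simp
  qed
  have ndiv: "\<not> summable (\<lambda>n. ((real (card (level n)))\<^sup>2 - real (card (level n))) / real (m n))"
  proof
    assume "summable (\<lambda>n. ((real (card (level n)))\<^sup>2 - real (card (level n))) / real (m n))"
    then have "summable (\<lambda>n. 2 * (((real (card (level n)))\<^sup>2 - real (card (level n))) / real (m n)))"
      by (rule summable_mult)
    then have "summable (\<lambda>n. 2 powr (- \<gamma> * real n) * ((real (card (level n)))\<^sup>2 - real (card (level n))))"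
    proof (rule summable_comparison_test'[where N = 0])
      fix n
      let ?c = "real (card (level n))"
      have c: "0 \<le> ?c\<^sup>2 - ?c"
        by (cases "card (level n)") (auto simp: power2_eq_square)
      have "2 powr (- \<gamma> * real n) = 2 / (2 * 2 powr (\<gamma> * real n))" by (simp add: powr_minus field_simps)
      also have "\<dots> \<le> 2 / real (m n)" using m[of n] m0[of n] by (intro divide_left_mono) auto
      finally have "2 powr (- \<gamma> * real n) * (?c\<^sup>2 - ?c) \<le> 2 / real (m n) * (?c\<^sup>2 - ?c)"
        using c by (intro mult_right_mono)
      then show "norm (2 powr (- \<gamma> * real n) * (?c\<^sup>2 - ?c)) \<le> 2 * ((?c\<^sup>2 - ?c) / real (m n))"
        using c by simp
    qed
    note W = weighted_count_sum_finite[OF fin \<gamma>(4) this]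
    from inf[OF \<gamma>(1)] have "AE \<omega> in M. False"
    proof eventually_elim
      case (elim \<omega>)
      then show ?case using W[of \<omega>] by simp
    qed
    then show False by simp
  qed
  from AE_same_box_pair[OF fin m0 ndiv, of n0] AE_points_distinct show ?thesis
  proof eventually_elim
    case (elim \<omega>)
    then obtain n i j where n: "n0 \<le> n" and ij: "i \<in> level n" "j \<in> level n" "i < j"
      and box: "box_index (m n) (\<theta> i \<omega>) = box_index (m n) (\<theta> j \<omega>)"
      by (auto simp: same_box_def)
    have "\<bar>\<theta> i \<omega> - \<theta> j \<omega>\<bar> \<le> 2 * pi / real (m n)" by (rule abs_diff_le_of_same_box[OF m0 box])
    also have "\<dots> \<le> 2 * pi / 2 powr (\<gamma> * real n)"
      using m[of n] m0[of n] by (intro divide_left_mono) auto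
    also have "\<dots> = 2 * pi * 2 powr (- \<gamma> * real n)" by (simp add: powr_minus field_simps)
    finally have "cmod (1 - cnj (pt j \<omega>) * pt i \<omega>) \<le> 10 * 2 powr (- \<gamma> * real n)"
      unfolding pt_def using ij radius \<gamma> by (intro one_minus_norm_le_powr) (auto simp: level_def)
    then have "rho_D (pt i \<omega>) (pt j \<omega>) \<le> d"
      using ij by (intro n0[OF n]) (auto simp: level_def)
    moreover have "pt i \<omega> \<noteq> pt j \<omega>" using elim(2) ij by (auto simp: level_def)
    ultimately show ?case by blast
  qed
qed

theorem AE_not_separated:
  assumes "\<And>\<gamma>. \<gamma> \<in> {1/2<..<1} \<Longrightarrow> AE \<omega> in M. weighted_count_sum \<gamma> (random_points \<rho> \<theta> \<omega>) = \<infinity>"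
  shows "AE \<omega> in M. \<not> D_separated (random_points \<rho> \<theta> \<omega>)"
proof -
  have "AE \<omega> in M. \<forall>n::nat. \<exists>j k. pt j \<omega> \<noteq> pt k \<omega> \<and> rho_D (pt j \<omega>) (pt k \<omega>) \<le> 1 / (real n + 3)"
    unfolding AE_all_countable by (intro allI AE_ex_close_pair assms) auto
  then show ?thesis
  proof (rule AE_mp, intro AE_I2 impI notI)
    fix \<omega>
    assume close: "\<forall>n::nat. \<exists>j k. pt j \<omega> \<noteq> pt k \<omega> \<and> rho_D (pt j \<omega>) (pt k \<omega>) \<le> 1 / (real n + 3)"
      and "D_separated (random_points \<rho> \<theta> \<omega>)"
    then obtain n :: nat where n: "\<And>j k. pt j \<omega> \<noteq> pt k \<omega> \<Longrightarrow> 1 / (real n + 2) \<le> rho_D (pt j \<omega>) (pt k \<omega>)"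
      unfolding random_points_eq D_separated_range_iff by blast
    obtain j k where "pt j \<omega> \<noteq> pt k \<omega>" "rho_D (pt j \<omega>) (pt k \<omega>) \<le> 1 / (real n + 3)" using close by blast
    moreover have "1 / (real n + 3) < 1 / (real n + 2)" by (simp add: field_simps)
    ultimately show False using n[of j k] by linarith
  qed
qed

end

theorem theorem1p7:
  fixes M :: "'a measure" and \<rho> :: "nat \<Rightarrow> real" and \<theta> :: "nat \<Rightarrow> 'a \<Rightarrow> real"
  assumes "prob_space M"
    and "\<And>k. 0 \<le> \<rho> k \<and> \<rho> k < 1"
    and "prob_space.indep_vars M (\<lambda>_. borel) \<theta> UNIV"
    and "\<And>k. distr M borel (\<theta> k) = uniform_measure lborel {0..2 * pi}"
  shows "{\<omega> \<in> space M. D_separated (random_points \<rho> \<theta> \<omega>)} \<in> sets M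
    \<and> ((\<exists>\<gamma>\<in>{1/2<..<1}. AE \<omega> in M. weighted_count_sum \<gamma> (random_points \<rho> \<theta> \<omega>) < \<infinity>)
        \<longrightarrow> measure M {\<omega> \<in> space M. D_separated (random_points \<rho> \<theta> \<omega>)} = 1)
    \<and> ((\<forall>\<gamma>\<in>{1/2<..<1}. AE \<omega> in M. weighted_count_sum \<gamma> (random_points \<rho> \<theta> \<omega>) = \<infinity>)
        \<longrightarrow> measure M {\<omega> \<in> space M. D_separated (random_points \<rho> \<theta> \<omega>)} = 0)"
proof -
  interpret prob_space M by fact
  interpret random_angles M \<rho> \<theta>
    by unfold_locales (use assms in auto)
  let ?S = "{\<omega> \<in> space M. D_separated (random_points \<rho> \<theta> \<omega>)}"
  have "prob ?S = 1" if "\<gamma> \<in> {1/2<..<1}" "AE \<omega> in M. weighted_count_sum \<gamma> (random_points \<rho> \<theta> \<omega>) < \<infinity>" for \<gamma>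
  proof -
    have "AE \<omega> in M. D_separated (random_points \<rho> \<theta> \<omega>)"
      using that by (intro AE_separated[of \<gamma>]) auto
    then show ?thesis using prob_Collect_eq_1[OF D_separated_event] by simp
  qed
  moreover have "prob ?S = 0"
    if "\<forall>\<gamma>\<in>{1/2<..<1}. AE \<omega> in M. weighted_count_sum \<gamma> (random_points \<rho> \<theta> \<omega>) = \<infinity>"
  proof -
    have "AE \<omega> in M. \<not> D_separated (random_points \<rho> \<theta> \<omega>)"
      using that by (intro AE_not_separated) auto
    then show ?thesis using prob_Collect_eq_0[OF D_separated_event] by simp
  qed
  ultimately show ?thesis using D_separated_event by blast
qed

end
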